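(* Let $X \geq 1$ be an integer and let $u(x)$ be a positive $C^{\infty}$-function with support in $[e, e^{1+q^{-X}}]$. Let $v(x) = \int_{t=x}^{\infty} u(t)\,\mathrm{d}t$, and take $u$ normalised so that $v(0)=1$. For $y \in \mathbb{C}\setminus\{0\}$ with $\arg(y)\neq \pi$ define $E_1(y) := \int_{w=y}^{y+\infty} \frac{e^{-w}}{w}\,\mathrm{d}w$, and for $z \in \mathbb{C}\setminus\{0\}$ with $\arg(z) \neq \pi$ define $$U(z) := \int_{x=0}^{\infty} u(x) E_1(z \log x)\,\mathrm{d}x .$$ Let $\chi$ be a primitive Dirichlet character of modulus $R \in \mathcal{M}\setminus\{1\}$, and let $\rho_n = \frac{1}{2} + i\gamma_n$ run over the zeros of $L(s,\chi)$ (counted with multiplicity). Then for all $s \in \mathbb{C}$, $$L(s,\chi) = P_X(s,\chi) Z_X(s,\chi),$$ where $$P_X(s,\chi) = \exp\Bigg( \sum_{\substack{A \in \mathcal{M} \\ \deg A \leq X}} \frac{\chi(A)\Lambda(A)}{|A|^s \log |A|} \Bigg), \qquad Z_X(s,\chi) = \exp\Bigg( -\sum_{\rho_n} U\big( (s-\rho_n)(\log q) X \big) \Bigg).$$ If $s = \rho$ or $\arg(s-\rho) = \pi$ for some zero $\rho$ of $L(s,\chi)$, then $Z_X(s,\chi)$ is defined as $\lim_{s_0 \to s} Z_X(s_0,\chi)$, and this limit exists (is well defined).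
   Context: $q$ is a prime power, $\mathcal{A} = \mathbb{F}_q[T]$, $\mathcal{M}$ is the set of monic polynomials in $\mathcal{A}$, and for nonzero $A$, $|A| := q^{\deg A}$. A Dirichlet character of modulus $R \in \mathcal{M}$ is a function $\chi:\mathcal{A}\to\mathbb{C}$ that is completely multiplicative, satisfies $\chi(A)=\chi(B)$ when $A \equiv B \pmod R$, and $\chi(A)=0$ iff $(A,R)\neq 1$. A divisor $S \mid R$ is an induced modulus of $\chi$ if there is a character $\chi_1$ mod $S$ with $\chi(A) = \chi_1(A)$ for $(A,R)=1$ (and $0$ otherwise); $\chi$ is primitive if there is no induced modulus of degree strictly less than $\deg R$. $L(s,\chi) := \sum_{A \in \mathcal{M}} \chi(A)|A|^{-s}$ for $\Re s>1$; for nontrivial $\chi$ this is a polynomial in $q^{-s}$, hence entire, and all its zeros lie on $\Re s = \frac12$ (they are vertically periodic with period $2\pi/\log q$, and the sum over zeros runs over all of them). $\Lambda(A) = \log|P|$ if $A = P^k$ for a monic irreducible $P$ and $k\geq 1$, and $\Lambda(A)=0$ otherwise. The integral $\int_{w=y}^{y+\infty}$ is along the horizontal ray starting at $y$ in the positive real direction. *)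

theory Defs
  imports "HOL-Complex_Analysis.Complex_Analysis" "HOL-Computational_Algebra.Polynomial_Factorial"
begin

definition monic_poly :: "'a::field poly \<Rightarrow> bool" where
  "monic_poly A \<longleftrightarrow> lead_coeff A = 1"

definition pabs :: "'a::{finite,field} poly \<Rightarrow> real" where
  "pabs A = real (CARD('a)) ^ degree A"

definition mangoldt_poly :: "'a::{finite,field} poly \<Rightarrow> real" where
  "mangoldt_poly A =
     (if \<exists>P k. monic_poly P \<and> irreducible P \<and> k \<ge> 1 \<and> A = P ^ k
      then ln (pabs (SOME P. \<exists>k. monic_poly P \<and> irreducible P \<and> k \<ge> 1 \<and> A = P ^ k))
      else 0)"

definition dirichlet_char :: "'a::{finite,field} poly \<Rightarrow> ('a poly \<Rightarrow> complex) \<Rightarrow> bool" where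
  "dirichlet_char R chi \<longleftrightarrow> monic_poly R \<and>
     (\<forall>A B. chi (A * B) = chi A * chi B) \<and>
     (\<forall>A B. A mod R = B mod R \<longrightarrow> chi A = chi B) \<and>
     (\<forall>A. chi A = 0 \<longleftrightarrow> \<not> coprime A R)"

definition induced_modulus :: "'a::{finite,field} poly \<Rightarrow> ('a poly \<Rightarrow> complex) \<Rightarrow> 'a poly \<Rightarrow> bool" where
  "induced_modulus R chi S \<longleftrightarrow> monic_poly S \<and> S dvd R \<and>
     (\<exists>chi1. dirichlet_char S chi1 \<and> (\<forall>A. chi A = (if coprime A R then chi1 A else 0)))"

definition primitive_char :: "'a::{finite,field} poly \<Rightarrow> ('a poly \<Rightarrow> complex) \<Rightarrow> bool" where
  "primitive_char R chi \<longleftrightarrow> dirichlet_char R chi \<and>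
     \<not> (\<exists>S. induced_modulus R chi S \<and> degree S < degree R)"

(* L(s,chi) = sum over monic A of chi(A) |A|^(-s), grouped by degree n:
   sum_n (sum_{deg A = n} chi A) q^(-n s); for nontrivial chi this is a polynomial in q^(-s). *)
definition Lfun :: "('a::{finite,field} poly \<Rightarrow> complex) \<Rightarrow> complex \<Rightarrow> complex" where
  "Lfun chi s = (\<Sum>n. (\<Sum>A\<in>{A. monic_poly A \<and> degree A = n}. chi A) *
                      exp (- s * of_nat n * of_real (ln (real (CARD('a))))))"

definition E1 :: "complex \<Rightarrow> complex" where
  "E1 y = integral {0..} (\<lambda>t::real. exp (- (y + of_real t)) / (y + of_real t))"

definition Ufun :: "(real \<Rightarrow> real) \<Rightarrow> complex \<Rightarrow> complex" where
  "Ufun u z = integral {0..} (\<lambda>x::real. of_real (u x) * E1 (z * of_real (ln x)))"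

definition PX :: "nat \<Rightarrow> ('a::{finite,field} poly \<Rightarrow> complex) \<Rightarrow> complex \<Rightarrow> complex" where
  "PX X chi s = exp (\<Sum>A\<in>{A. monic_poly A \<and> degree A \<le> X}.
      chi A * of_real (mangoldt_poly A) /
        (exp (s * of_real (ln (pabs A))) * of_real (ln (pabs A))))"

definition exc_set :: "('a::{finite,field} poly \<Rightarrow> complex) \<Rightarrow> complex set" where
  "exc_set chi = {s. \<exists>\<rho>. Lfun chi \<rho> = 0 \<and> (s = \<rho> \<or> Arg (s - \<rho>) = pi)}"

(* Z_X(s,chi) = exp(- sum over zeros (with multiplicity) of U((s - rho)(log q) X)),
   for s outside the exceptional set *)
definition ZX :: "(real \<Rightarrow> real) \<Rightarrow> nat \<Rightarrow> ('a::{finite,field} poly \<Rightarrow> complex) \<Rightarrow> complex \<Rightarrow> complex" where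
  "ZX u X chi s = exp (- (\<Sum>\<^sub>\<infinity>\<rho>\<in>{\<rho>. Lfun chi \<rho> = 0}.
      of_int (zorder (Lfun chi) \<rho>) *
        Ufun u ((s - \<rho>) * of_real (ln (real (CARD('a)))) * of_nat X)))"

definition smooth_fun :: "(real \<Rightarrow> real) \<Rightarrow> bool" where
  "smooth_fun u \<longleftrightarrow> (\<forall>n x. ((deriv ^^ n) u) differentiable (at x))"

end

(*
Write x = q^(-s). For a nonprincipal character L(s, chi) = C(x) with a polynomial C, C(0) = 1, so
C(x) is the product of (1 - x/b)^m over its roots b. Comparing logarithmic derivatives (Newton's
identities) gives P_X = exp (- sum over b of m * sum over n <= X of (x/b)^n / n), hence
L = P_X * product over b of ((1 - x/b) * exp (sum over n <= X of (x/b)^n / n))^m.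
The zeros of L above the root b form a vertical progression of period 2 pi i / log q, so it remains
to show, with exp (-W) = x/b,
  exp (- sum over k of U ((W - 2 pi i k) X)) = (1 - exp (-W)) * exp (sum over n <= X of exp (-nW) / n).
Here U (zX) is the integral over r >= 0 of M(z + r) / (z + r), where M is a Laplace transform over
an interval of length at most 1 (after rescaling log x by X). Thus the M(w - 2 pi i k) / (w - 2 pi i k)
are the Fourier coefficients of a 1-periodic function, and they sum to its value
exp (-Xw) / (exp w - 1) at 0. This is the logarithmic derivative of the right hand side, which tends
to 1 as w goes to infinity along the ray; integrate. Smoothness of u makes everything absolutely convergent.
*)
theory Submission
  imports Defs "HOL-Computational_Algebra.Fundamental_Theorem_Algebra"
begin

section \<open>The von Mangoldt function on monic polynomials\<close>

text \<open>Two modes of convergence have to be reconciled. The Fourier series yields only the limit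
  of symmetric partial sums over k, while the sum over zeros in \<open>ZX\<close> is unordered. One
  integration by parts gives M(z) = O(1/|z|), with exponential decay along each ray, so that M(z)/z
  is O(1/|z|^2). This single bound gives absolute summability over k, integrability in r and the
  domination that permits exchanging sum and integral. The number X enters twice. The support of
  \<open>u\<close> has logarithmic width q^(-X) < 1/X, so X * ln x stays in [X, X + 1], one full
  period of the characters. And since X is an integer, the shift by X does not disturb the
  characters and only contributes the factor exp (-Xw). The final identity is compared through
  exponentials, by a product whose derivative along the ray is zero, so no branch of its logarithm
  is chosen. The exceptional points s are those for which some ray meets the pole at 0; there Z_X is
  read off from the continuous quotient L / P_X, as P_X has no zeros.\<close>

lemma finite_monic_degree_eq: "finite {A :: 'a::{finite,field} poly. monic_poly A \<and> degree A = n}"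
proof (rule finite_subset)
  show "{A :: 'a poly. monic_poly A \<and> degree A = n} \<subseteq> Poly ` {xs. set xs \<subseteq> UNIV \<and> length xs \<le> Suc n}"
  proof
    fix A :: "'a poly" assume "A \<in> {A. monic_poly A \<and> degree A = n}"
    hence "length (coeffs A) \<le> Suc n" by (cases "A = 0") (auto simp: length_coeffs_degree)
    thus "A \<in> Poly ` {xs. set xs \<subseteq> UNIV \<and> length xs \<le> Suc n}"
      by (intro image_eqI[of _ _ "coeffs A"]) auto
  qed
  show "finite (Poly ` {xs :: 'a list. set xs \<subseteq> UNIV \<and> length xs \<le> Suc n})"
    by (intro finite_imageI finite_lists_length_le) auto
qed

lemma finite_monic_degree_le: "finite {A :: 'a::{finite,field} poly. monic_poly A \<and> degree A \<le> n}"
proof -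
  have "{A :: 'a poly. monic_poly A \<and> degree A \<le> n} = (\<Union>k\<le>n. {A. monic_poly A \<and> degree A = k})"
    by auto
  thus ?thesis using finite_monic_degree_eq by (simp only: finite_UN finite_atMost) blast
qed

lemma monic_poly_nonzero: "monic_poly (A :: 'a::field poly) \<Longrightarrow> A \<noteq> 0"
  by (auto simp: monic_poly_def)

lemma monic_poly_mult: "monic_poly (A :: 'a::field poly) \<Longrightarrow> monic_poly B \<Longrightarrow> monic_poly (A * B)"
  by (simp add: monic_poly_def lead_coeff_mult)

lemma monic_poly_power: "monic_poly (A :: 'a::field poly) \<Longrightarrow> monic_poly (A ^ k)"
  by (simp add: monic_poly_def lead_coeff_power)

lemma monic_poly_cofactor: "monic_poly (A * B :: 'a::field poly) \<Longrightarrow> monic_poly A \<Longrightarrow> monic_poly B"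
  by (simp add: monic_poly_def lead_coeff_mult)

lemma monic_poly_degree_0: "monic_poly (A :: 'a::field poly) \<Longrightarrow> degree A = 0 \<Longrightarrow> A = 1"
  by (metis degree_0_id lead_coeff_1 monic_poly_def of_nat_1 one_pCons degree_eq_zeroE lead_coeff_pCons(2))

lemma monic_poly_dvd_antisym:
  assumes "A dvd B" "B dvd A" "monic_poly (A :: 'a::field poly)" "monic_poly B"
  shows "A = B"
proof -
  obtain C where C: "B = A * C" using assms by auto
  have "degree A = degree B"
    using assms by (metis dvd_imp_degree_le monic_poly_nonzero order_antisym)
  hence "degree C = 0" using C assms(3,4) monic_poly_nonzero[of A] monic_poly_nonzero[of B] by (auto simp: degree_mult_eq)
  moreover have "monic_poly C" using C assms monic_poly_cofactor by blast
  ultimately show ?thesis using C monic_poly_degree_0[of C] by simp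
qed

lemma irreducible_degree_pos: "irreducible (P :: 'a::field poly) \<Longrightarrow> degree P > 0"
  by (metis gr0I irreducible_def is_unit_iff_degree)

text \<open>Forces two prime powers that agree to have the same base, which makes the
  \<open>SOME\<close> in \<open>mangoldt_poly\<close> well determined.\<close>

lemma monic_irreducible_dvd_power_eq:
  assumes "monic_poly (P :: 'a::field poly)" "irreducible P" "monic_poly Q" "irreducible Q" "P dvd Q ^ k"
  shows "P = Q"
proof -
  have "prime_elem P" using assms by (simp add: field_poly_irreducible_imp_prime)
  hence "P dvd Q" using assms(5) prime_elem_dvd_power by blast
  hence "Q dvd P" using assms by (metis irreducible_altdef irreducible_def)
  thus ?thesis using \<open>P dvd Q\<close> assms monic_poly_dvd_antisym by blast
qed

lemma ln_pabs: "ln (pabs (A :: 'a::{finite,field} poly)) = degree A * ln (real CARD('a))"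
  by (simp add: pabs_def ln_realpow)

lemma mangoldt_poly_prime_power:
  assumes "monic_poly (P :: 'a::{finite,field} poly)" "irreducible P" "k \<ge> 1"
  shows "mangoldt_poly (P ^ k) = degree P * ln (real CARD('a))"
proof -
  have "(SOME Q. \<exists>j. monic_poly Q \<and> irreducible Q \<and> j \<ge> 1 \<and> P ^ k = Q ^ j) = P"
  proof (rule some_equality)
    fix Q assume "\<exists>j. monic_poly Q \<and> irreducible Q \<and> j \<ge> 1 \<and> P ^ k = Q ^ j"
    then obtain j where "monic_poly Q" "irreducible Q" "j \<ge> 1" "P ^ k = Q ^ j" by blast
    thus "Q = P" using assms
      by (metis dvd_power le_eq_less_or_eq less_le_trans monic_irreducible_dvd_power_eq zero_less_one)
  qed (use assms in blast)
  thus ?thesis unfolding mangoldt_poly_def using assms by (auto simp: ln_pabs)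
qed

lemma mangoldt_poly_nonzeroE:
  assumes "mangoldt_poly (A :: 'a::{finite,field} poly) \<noteq> 0"
  obtains P k where "monic_poly P" "irreducible P" "k \<ge> 1" "A = P ^ k"
  using assms unfolding mangoldt_poly_def by (auto split: if_splits)

lemma finite_monic_divisors:
  "monic_poly (A :: 'a::{finite,field} poly) \<Longrightarrow> finite {D. monic_poly D \<and> D dvd A}"
  by (rule finite_subset[OF _ finite_monic_degree_le[of "degree A"]])
     (auto intro: dvd_imp_degree_le dest: monic_poly_nonzero)

text \<open>A divisor of least positive degree has no proper factor; dividing by its leading
  coefficient makes it monic.\<close>

lemma exists_monic_irreducible_divisor:
  assumes "degree (A :: 'a::field poly) > 0"
  obtains P where "monic_poly P" "irreducible P" "P dvd A"
proof -
  define Q where "Q = (\<lambda>B. B dvd A \<and> degree B > 0)"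
  define B where "B = arg_min degree Q"
  have QA: "Q A" using assms by (simp add: Q_def)
  have QB: "Q B" using arg_min_natI[of Q A degree] QA by (simp add: B_def)
  have Bmin: "degree B \<le> degree C" if "Q C" for C using arg_min_nat_le[of Q C degree] that by (simp add: B_def)
  have "B \<noteq> 0" using QB by (auto simp: Q_def)
  have "irreducible B"
  proof (rule irreducibleI)
    show "\<not> B dvd 1" using QB is_unit_iff_degree[OF \<open>B \<noteq> 0\<close>] by (simp add: Q_def)
    fix C D assume CD: "B = C * D"
    have nz: "C \<noteq> 0" "D \<noteq> 0" using CD \<open>B \<noteq> 0\<close> by auto
    have deg: "degree B = degree C + degree D" using CD nz by (simp add: degree_mult_eq)
    show "C dvd 1 \<or> D dvd 1"
    proof (rule ccontr)
      assume *: "\<not> (C dvd 1 \<or> D dvd 1)"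
      hence "degree C > 0" "degree D > 0" using nz by (auto simp: is_unit_iff_degree)
      moreover have "C dvd A" using QB CD by (auto simp: Q_def dest: dvd_mult_left)
      ultimately have "degree B \<le> degree C" using Bmin by (simp add: Q_def)
      thus False using deg \<open>degree D > 0\<close> by simp
    qed
  qed fact
  hence B: "irreducible B" "B dvd A" using QB by (auto simp: Q_def)
  define c where "c = inverse (lead_coeff B)"
  have c: "c \<noteq> 0" using B by (auto simp: c_def irreducible_def)
  have "monic_poly (smult c B)" using B c by (auto simp: monic_poly_def c_def irreducible_def)
  moreover have "irreducible (smult c B)" using B c irreducible_mult_unit_left[of "[:c:]" B] is_unit_iff_degree[of "[:c:]"] by simp
  moreover have "smult c B dvd A" using B c by (simp add: smult_dvd_iff)
  ultimately show ?thesis using that by blast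
qed

text \<open>The analogue of log n being the sum of Lambda over the divisors of n. Split off the full
  power P^k of one prime: the prime powers dividing P^k * B are P, ..., P^k and those dividing B, so
  k copies of deg P are added to the induction hypothesis for B.\<close>

lemma sum_mangoldt_poly_divisors:
  assumes "monic_poly (A :: 'a::{finite,field} poly)"
  shows "(\<Sum>D\<in>{D. monic_poly D \<and> D dvd A}. mangoldt_poly D) = degree A * ln (real CARD('a))"
  using assms
proof (induction "degree A" arbitrary: A rule: less_induct)
  case less
  show ?case
  proof (cases "degree A = 0")
    case True
    hence "A = 1" using less.prems monic_poly_degree_0 by blast
    moreover have "{D :: 'a poly. monic_poly D \<and> D dvd 1} = {1}"
      by (auto simp: is_unit_iff_degree monic_poly_nonzero monic_poly_degree_0) (simp add: monic_poly_def)
    moreover have "mangoldt_poly (1 :: 'a poly) = 0"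
    proof (rule ccontr)
      assume "mangoldt_poly (1 :: 'a poly) \<noteq> 0"
      then obtain P :: "'a poly" and k where "irreducible P" "k \<ge> 1" "1 = P ^ k"
        by (elim mangoldt_poly_nonzeroE)
      thus False by (metis dvd_power irreducible_def less_le_trans zero_less_one)
    qed
    ultimately show ?thesis by simp
  next
    case False
    then obtain P where P: "monic_poly P" "irreducible P" "P dvd A"
      using exists_monic_irreducible_divisor[of A] by auto
    have Ap: "prime_elem P" using P by (simp add: field_poly_irreducible_imp_prime)
    have A0: "A \<noteq> 0" using less.prems monic_poly_nonzero by blast
    define k where "k = (GREATEST k. P ^ k dvd A)"
    have bnd: "j \<le> degree A" if "P ^ j dvd A" for j
    proof -
      have "j * degree P \<le> degree A"
        using dvd_imp_degree_le[OF that A0] P by (simp add: degree_power_eq monic_poly_nonzero)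
      moreover have "j * 1 \<le> j * degree P"
        using irreducible_degree_pos[OF P(2)] by (intro mult_le_mono2) simp
      ultimately show ?thesis by linarith
    qed
    have "P ^ k dvd A" unfolding k_def
      by (rule GreatestI_nat[where k = 0 and b = "degree A"]) (use bnd in auto)
    then obtain B where kB1: "A = P ^ k * B" by auto
    have "\<not> P dvd B"
    proof
      assume "P dvd B"
      hence "P ^ Suc k dvd A" unfolding kB1 by (auto simp: mult_dvd_mono mult.commute)
      hence "Suc k \<le> k" unfolding k_def by (intro Greatest_le_nat[where b = "degree A"]) (use bnd in auto)
      thus False by simp
    qed
    note kB = kB1 this
    have k: "k \<ge> 1" using kB P by (cases k) auto
    have B: "monic_poly B" using kB less.prems monic_poly_cofactor[OF _ monic_poly_power[OF P(1)]] by auto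
    have dA: "degree A = k * degree P + degree B"
      using kB A0 by (auto simp: degree_mult_eq degree_power_eq)
    have lt: "degree B < degree A" using dA k irreducible_degree_pos[OF P(2)] by simp
    let ?S = "\<lambda>A. {D. monic_poly D \<and> D dvd A}"
    have fin: "finite (?S A)" "finite (?S B)" using finite_monic_divisors less.prems B by auto
    have inj: "inj_on (\<lambda>j. P ^ j) {1..k}"
    proof (rule inj_onI)
      fix i j assume "P ^ i = P ^ j"
      hence "degree (P ^ i) = degree (P ^ j)" by simp
      thus "i = j" using irreducible_degree_pos[OF P(2)] P by (auto simp: degree_power_eq monic_poly_nonzero)
    qed
    have disj: "(\<lambda>j. P ^ j) ` {1..k} \<inter> ?S B = {}"
      using kB(2) by auto
    have sub: "(\<lambda>j. P ^ j) ` {1..k} \<union> ?S B \<subseteq> ?S A"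
      using kB(1) P by (auto simp: monic_poly_power le_imp_power_dvd)
    \<comment> \<open>A further prime power Q^j dividing A cannot exist: for Q = P its exponent
      would exceed k, and otherwise Q^j already divides B.\<close>
    have rest: "mangoldt_poly D = 0" if D: "D \<in> ?S A - ((\<lambda>j. P ^ j) ` {1..k} \<union> ?S B)" for D
    proof (rule ccontr)
      assume "mangoldt_poly D \<noteq> 0"
      then obtain Q j where Q: "monic_poly Q" "irreducible Q" "j \<ge> 1" "D = Q ^ j"
        by (elim mangoldt_poly_nonzeroE)
      show False
      proof (cases "Q = P")
        case True
        have "\<not> j \<le> k" using D Q True by auto
        hence "P ^ Suc k dvd A" using D Q(4) True
          by (metis DiffD1 dvd_trans le_imp_power_dvd mem_Collect_eq not_less_eq_eq)
        hence "P ^ k * P dvd P ^ k * B" using kB by (simp add: mult.commute)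
        thus False using kB P by (simp add: monic_poly_nonzero)
      next
        case False
        have "\<not> Q dvd P"
          using Q P False monic_irreducible_dvd_power_eq[of Q P 1] by auto
        moreover have "prime_elem Q" using Q by (simp add: field_poly_irreducible_imp_prime)
        ultimately have "\<not> Q dvd P ^ k" by (auto dest: prime_elem_dvd_power)
        have "Q ^ j dvd P ^ k * B" using D kB Q by simp
        then obtain a b where ab: "a + b = j" "Q ^ a dvd P ^ k" "Q ^ b dvd B"
          using prime_elem_power_dvd_prod[OF _ \<open>prime_elem Q\<close>] by blast
        have "a = 0"
        proof (rule ccontr)
          assume "a \<noteq> 0"
          hence "Q dvd P ^ k" using ab(2) by (meson dvd_power dvd_trans neq0_conv)
          thus False using \<open>\<not> Q dvd P ^ k\<close> by simp
        qed
        hence "D dvd B" using ab Q(4) by simp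
        thus False using D by auto
      qed
    qed
    have "sum mangoldt_poly (?S A) = sum mangoldt_poly ((\<lambda>j. P ^ j) ` {1..k} \<union> ?S B)"
      using fin sub rest by (intro sum.mono_neutral_right) auto
    also have "\<dots> = sum mangoldt_poly ((\<lambda>j. P ^ j) ` {1..k}) + sum mangoldt_poly (?S B)"
      using fin disj by (intro sum.union_disjoint) auto
    also have "sum mangoldt_poly ((\<lambda>j. P ^ j) ` {1..k}) = (\<Sum>j\<in>{1..k}. degree P * ln (real CARD('a)))"
      using inj P by (subst sum.reindex) (auto intro!: sum.cong simp: mangoldt_poly_prime_power)
    also have "sum mangoldt_poly (?S B) = degree B * ln (real CARD('a))" using less.hyps lt B by blast
    finally show ?thesis using dA by (simp add: algebra_simps)
  qed
qed

section \<open>Coefficients of the L-function\<close>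

lemma
  assumes "dirichlet_char R chi"
  shows dirichlet_char_modulus_nonzero: "R \<noteq> 0"
    and dirichlet_char_modulus_monic: "monic_poly R"
    and dirichlet_char_mult: "chi (A * B) = chi A * chi B"
    and dirichlet_char_cong: "A mod R = B mod R \<Longrightarrow> chi A = chi B"
    and dirichlet_char_eq_0_iff: "chi A = 0 \<longleftrightarrow> \<not> coprime A R"
  using assms monic_poly_nonzero unfolding dirichlet_char_def by blast+

lemma dirichlet_char_1:
  assumes "dirichlet_char R chi"
  shows "chi 1 = 1"
  using dirichlet_char_mult[OF assms, of 1 1] dirichlet_char_eq_0_iff[OF assms, of 1] by simp

text \<open>Euclid's algorithm: the pair is replaced by \<open>B\<close> and \<open>A mod B\<close>,
  and the coefficients are substituted back.\<close>

lemma coprime_poly_bezout: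
  assumes "coprime A (B :: 'a::field poly)"
  shows "\<exists>U V. U * A + V * B = 1"
  using assms
proof (induction "degree B" arbitrary: A B rule: less_induct)
  case less
  show ?case
  proof (cases "B = 0")
    case True
    hence "A dvd 1" using less.prems by simp
    then obtain U where "1 = A * U" by (elim dvdE)
    thus ?thesis using True by (intro exI[of _ U] exI[of _ 0]) (simp add: mult.commute)
  next
    case False
    have cop: "coprime B (A mod B)"
      using less.prems by (auto simp: coprime_def dvd_mod_iff)
    \<comment> \<open>A zero remainder is treated apart because its degree counts as 0, which is no
      decrease when \<open>B\<close> is constant.\<close>
    show ?thesis
    proof (cases "A mod B = 0")
      case True
      hence "B dvd 1" using cop by simp
      then obtain V where "1 = B * V" by (elim dvdE)
      thus ?thesis by (intro exI[of _ 0] exI[of _ V]) (simp add: mult.commute)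
    next
      case nz: False
      hence "degree (A mod B) < degree B" using degree_mod_less[OF False, of A] by simp
      from less.hyps[OF this cop] obtain U V where UV: "U * B + V * (A mod B) = 1" by blast
      have "V * A + (U - V * (A div B)) * B = U * B + V * (A - A div B * B)" by (simp add: algebra_simps)
      also have "\<dots> = 1" using UV by (simp add: minus_div_mult_eq_mod)
      finally show ?thesis by blast
    qed
  qed
qed

lemma coprime_poly_dvd_mult_cancel:
  assumes "coprime A R" "R dvd A * (B :: 'a::field poly)"
  shows "R dvd B"
proof -
  obtain U V where "U * A + V * R = 1" using coprime_poly_bezout[OF assms(1)] by blast
  hence "B = (U * A + V * R) * B" by simp
  hence "B = U * (A * B) + V * B * R" by (simp add: algebra_simps)
  moreover have "R dvd U * (A * B) + V * B * R" using assms(2) by (intro dvd_add) auto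
  ultimately show ?thesis by simp
qed

definition Lcoeff :: "('a::{finite,field} poly \<Rightarrow> complex) \<Rightarrow> nat \<Rightarrow> complex" where
  "Lcoeff chi n = (\<Sum>A\<in>{A. monic_poly A \<and> degree A = n}. chi A)"

text \<open>The coefficients of -L'/L as a power series in q^(-s).\<close>

definition Mcoeff :: "('a::{finite,field} poly \<Rightarrow> complex) \<Rightarrow> nat \<Rightarrow> complex" where
  "Mcoeff chi n = (\<Sum>A\<in>{A. monic_poly A \<and> degree A = n}. chi A * of_real (mangoldt_poly A))"

lemma Lcoeff_0:
  assumes "dirichlet_char R chi"
  shows "Lcoeff chi 0 = 1"
proof -
  have "{A :: 'a poly. monic_poly A \<and> degree A = 0} = {1}"
    by (auto simp: monic_poly_degree_0) (simp add: monic_poly_def)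
  thus ?thesis using dirichlet_char_1[OF assms] by (simp add: Lcoeff_def)
qed

text \<open>Coefficient form of -L' = L * (-L'/L): write log |A| as the divisor sum of the von
  Mangoldt function, then regroup the pairs of A and D by the degree of D, using that
  \<open>chi\<close> is multiplicative.\<close>

lemma Lcoeff_recurrence:
  fixes chi :: "'a::{finite,field} poly \<Rightarrow> complex"
  assumes "dirichlet_char R chi"
  shows "of_nat n * of_real (ln (real CARD('a))) * Lcoeff chi n =
         (\<Sum>j\<le>n. Mcoeff chi j * Lcoeff chi (n - j))"
proof -
  let ?m = "\<lambda>n. {A :: 'a poly. monic_poly A \<and> degree A = n}"
  let ?f = "\<lambda>D B. chi D * of_real (mangoldt_poly D) * chi B"
  have mult: "chi (A * B) = chi A * chi B" for A B
    using dirichlet_char_mult[OF assms] .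
  have "of_nat n * of_real (ln (real CARD('a))) * Lcoeff chi n =
        (\<Sum>A\<in>?m n. chi A * of_real (degree A * ln (real CARD('a))))"
    unfolding Lcoeff_def sum_distrib_left by (intro sum.cong) auto
  also have "\<dots> = (\<Sum>A\<in>?m n. \<Sum>D\<in>{D. monic_poly D \<and> D dvd A}. chi A * of_real (mangoldt_poly D))"
  proof (intro sum.cong refl)
    fix A :: "'a poly" assume "A \<in> ?m n"
    hence "degree A * ln (real CARD('a)) = (\<Sum>D\<in>{D. monic_poly D \<and> D dvd A}. mangoldt_poly D)"
      by (simp add: sum_mangoldt_poly_divisors)
    thus "chi A * of_real (degree A * ln (real CARD('a))) =
          (\<Sum>D\<in>{D. monic_poly D \<and> D dvd A}. chi A * of_real (mangoldt_poly D))"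
      by (simp only: of_real_sum sum_distrib_left)
  qed
  also have "\<dots> = (\<Sum>(A, D)\<in>(SIGMA A:?m n. {D. monic_poly D \<and> D dvd A}). chi A * of_real (mangoldt_poly D))"
    by (intro sum.Sigma) (auto simp: finite_monic_degree_eq finite_monic_divisors)
  also have "\<dots> = (\<Sum>(j, D, B)\<in>(SIGMA j:{..n}. ?m j \<times> ?m (n - j)). ?f D B)"
    by (intro sum.reindex_bij_witness[where
          j = "\<lambda>(A, D). (degree D, D, A div D)" and i = "\<lambda>(j, D, B). (D * B, D)"])
       (auto simp: monic_poly_mult monic_poly_nonzero degree_mult_eq mult ac_simps
         elim!: dvdE dest: monic_poly_cofactor intro: dvd_imp_degree_le)
  also have "\<dots> = (\<Sum>j\<le>n. \<Sum>(D, B)\<in>?m j \<times> ?m (n - j). ?f D B)"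
    by (subst sum.Sigma) (auto simp: finite_monic_degree_eq)
  also have "\<dots> = (\<Sum>j\<le>n. Mcoeff chi j * Lcoeff chi (n - j))"
    unfolding Mcoeff_def Lcoeff_def sum_product sum.cartesian_product ..
  finally show ?thesis .
qed

text \<open>Multiplying the residue mod \<open>R\<close> by the unit \<open>B\<close> while keeping
  the quotient permutes the monic polynomials of degree n, since for n >= deg R the top coefficient
  is not touched. The sum therefore equals \<open>chi B\<close> times itself.\<close>

lemma Lcoeff_eq_0:
  fixes chi :: "'a::{finite,field} poly \<Rightarrow> complex"
  assumes "dirichlet_char R chi" "coprime B R" "chi B \<noteq> 1" "degree R \<le> n"
  shows "Lcoeff chi n = 0"
proof -
  let ?m = "{A :: 'a poly. monic_poly A \<and> degree A = n}"
  have mult: "chi (A * B) = chi A * chi B" and per: "A mod R = B mod R \<Longrightarrow> chi A = chi B" for A B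
    using dirichlet_char_mult[OF assms(1)] dirichlet_char_cong[OF assms(1)] by blast+
  have R0: "R \<noteq> 0" using dirichlet_char_modulus_nonzero[OF assms(1)] .
  define f where "f = (\<lambda>A. A div R * R + (B * A) mod R)"
  have fmod: "f A mod R = (B * A) mod R" for A by (simp add: f_def)
  have fdiv: "f A div R = A div R" for A
    using R0 by (simp add: f_def)
  have dr: "degree (A mod R) < n \<or> A mod R = 0" for A
    using degree_mod_less[OF R0, of A] assms(4) by auto
  have f_mem: "f A \<in> ?m" if "A \<in> ?m" for A
  proof -
    have eq: "f A = A + ((B * A) mod R - A mod R)" 
      unfolding f_def by (simp add: algebra_simps flip: minus_mod_eq_mult_div)
    show ?thesis
    proof (cases "(B * A) mod R - A mod R = 0")
      case True thus ?thesis using eq that by simp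
    next
      case False
      hence "degree ((B * A) mod R - A mod R) < n"
        using dr[of A] dr[of "B * A"] degree_diff_less[of "B*A mod R" n "A mod R"] by auto
      hence "degree (f A) = n \<and> lead_coeff (f A) = 1" unfolding eq using that
        using coeff_eq_0[of "(B * A) mod R - A mod R" n]
        by (auto simp: degree_add_eq_left monic_poly_def)
      thus ?thesis by (auto simp: monic_poly_def)
    qed
  qed
  have inj: "inj_on f ?m"
  proof (rule inj_onI)
    fix A C assume "f A = f C"
    hence d: "A div R = C div R" "(B * A) mod R = (B * C) mod R" using fdiv fmod by metis+
    hence "R dvd B * (A - C)" by (simp add: mod_eq_dvd_iff algebra_simps)
    hence "R dvd A - C" using coprime_poly_dvd_mult_cancel[OF assms(2)] by blast
    hence "A mod R = C mod R" by (simp add: mod_eq_dvd_iff)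
    thus "A = C" using d(1) by (metis div_mult_mod_eq)
  qed
  have "f ` ?m = ?m"
    using f_mem inj by (intro endo_inj_surj finite_monic_degree_eq) auto
  hence "Lcoeff chi n = (\<Sum>A\<in>f ` ?m. chi A)" by (simp add: Lcoeff_def)
  also have "\<dots> = (\<Sum>A\<in>?m. chi B * chi A)"
    using inj per[OF fmod] by (subst sum.reindex) (auto intro!: sum.cong simp flip: mult)
  also have "\<dots> = chi B * Lcoeff chi n" by (simp add: Lcoeff_def sum_distrib_left)
  finally show ?thesis using assms(3) by simp
qed

text \<open>If \<open>chi\<close> were 1 on everything coprime to \<open>R\<close>, the constant
  character mod 1 would induce it, with a modulus of smaller degree.\<close>

lemma primitive_char_nonprincipal:
  assumes "primitive_char R chi" "R \<noteq> 1"
  obtains B where "coprime B R" "chi B \<noteq> 1"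
proof (rule ccontr)
  assume *: "\<not> thesis"
  have d: "dirichlet_char R chi" using assms by (simp add: primitive_char_def)
  have "chi A = 1" if "coprime A R" for A using that * d \<open>\<And>B. coprime B R \<Longrightarrow> chi B \<noteq> 1 \<Longrightarrow> thesis\<close> by blast
  moreover have "chi A = 0" if "\<not> coprime A R" for A using that dirichlet_char_eq_0_iff[OF d] by blast
  moreover have "dirichlet_char 1 (\<lambda>_. 1 :: complex)" by (simp add: dirichlet_char_def monic_poly_def)
  ultimately have "induced_modulus R chi 1"
    unfolding induced_modulus_def by (auto simp: monic_poly_def intro!: exI[of _ "\<lambda>_. 1"])
  moreover have "degree (1 :: 'a poly) < degree R"
    using assms(2) dirichlet_char_modulus_monic[OF d] monic_poly_degree_0[of R] by auto
  ultimately show False using assms(1) unfolding primitive_char_def by blast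
qed

section \<open>Factorisation of the L-polynomial\<close>

text \<open>For F = x - b, x F'/F = x / (x - b) is minus the sum of (x/b)^n over n >= 1. The form x
  F' = D * F avoids dividing series and lets factors be combined by the product rule.\<close>

lemma fps_log_deriv_linear:
  assumes "b \<noteq> (0 :: complex)"
  shows "fps_X * fps_deriv (fps_of_poly [:-b, 1:]) =
         Abs_fps (\<lambda>n. if n = 0 then 0 else - (inverse b ^ n)) * fps_of_poly [:-b, 1:]"
proof (rule fps_ext)
  fix n
  have *: "fps_of_poly [:-b, 1:] = fps_X - fps_const b"
    by (simp add: fps_of_poly_pCons)
  show "fps_nth (fps_X * fps_deriv (fps_of_poly [:-b, 1:])) n = 
        fps_nth (Abs_fps (\<lambda>n. if n = 0 then 0 else - (inverse b ^ n)) * fps_of_poly [:-b, 1:]) n"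
    unfolding * using assms
    by (cases n) (auto simp: right_diff_distrib fps_mult_right_const_nth field_simps)
qed

lemma fps_log_deriv_power:
  assumes "fps_X * fps_deriv F = D * F"
  shows "fps_X * fps_deriv (F ^ m) = (of_nat m * D) * (F ^ m :: complex fps)"
proof (induction m)
  case (Suc m)
  have "fps_X * fps_deriv (F ^ Suc m) = (fps_X * fps_deriv F) * F ^ m + F * (fps_X * fps_deriv (F ^ m))"
    by (simp add: algebra_simps)
  also have "\<dots> = (of_nat (Suc m) * D) * F ^ Suc m" unfolding Suc assms by (simp add: algebra_simps)
  finally show ?case .
qed simp

lemma fps_log_deriv_prod:
  assumes "finite S" "\<And>z. z \<in> S \<Longrightarrow> fps_X * fps_deriv (F z) = D z * F z"
  shows "fps_X * fps_deriv (\<Prod>z\<in>S. F z) = (\<Sum>z\<in>S. D z) * (\<Prod>z\<in>S. F z :: complex fps)"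
  using assms
proof (induction rule: finite_induct)
  case (insert x S)
  have "fps_X * fps_deriv (\<Prod>z\<in>insert x S. F z) =
        (fps_X * fps_deriv (F x)) * prod F S + F x * (fps_X * fps_deriv (prod F S))"
    using insert.hyps by (simp add: algebra_simps)
  also have "fps_X * fps_deriv (F x) = D x * F x" using insert.prems by simp
  also have "fps_X * fps_deriv (prod F S) = sum D S * prod F S" using insert by simp
  also have "D x * F x * prod F S + F x * (sum D S * prod F S) = (D x + sum D S) * (F x * prod F S)"
    by (simp add: algebra_simps)
  finally show ?case using insert by simp
qed simp

text \<open>Over the factorisation into linear factors, the product rule adds up the power sums of
  the inverse roots, and the leading coefficient cancels. \<open>poly C 0 \<noteq> 0\<close> keeps
  the roots away from 0, where \<open>inverse b\<close> would be a default value.\<close>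

lemma fps_log_deriv_poly:
  fixes C :: "complex poly"
  assumes "poly C 0 \<noteq> 0"
  shows "fps_X * fps_deriv (fps_of_poly C) =
    Abs_fps (\<lambda>n. if n = 0 then 0 else - (\<Sum>b | poly C b = 0. of_nat (order b C) * inverse b ^ n)) * fps_of_poly C"
proof -
  define S where "S = {b. poly C b = 0}"
  have C0: "C \<noteq> 0" using assms by auto
  have fin: "finite S" using C0 poly_roots_finite unfolding S_def by blast
  define D where "D = (\<lambda>b. of_nat (order b C) * Abs_fps (\<lambda>n. if n = 0 then 0 else - (inverse b ^ n)) :: complex fps)"
  have "C = smult (lead_coeff C) (\<Prod>b\<in>S. [:-b, 1:] ^ order b C)"
    unfolding S_def by (simp add: complex_poly_decompose)
  hence F: "fps_of_poly C = fps_const (lead_coeff C) * (\<Prod>b\<in>S. fps_of_poly [:-b, 1:] ^ order b C)"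
    by (metis (no_types, lifting) fps_of_poly_power fps_of_poly_prod fps_of_poly_smult prod.cong)
  have "fps_X * fps_deriv (\<Prod>b\<in>S. fps_of_poly [:-b, 1:] ^ order b C) =
        sum D S * (\<Prod>b\<in>S. fps_of_poly [:-b, 1:] ^ order b C)"
    unfolding D_def using assms
    by (intro fps_log_deriv_prod fin fps_log_deriv_power fps_log_deriv_linear) (auto simp: S_def)
  hence "fps_X * fps_deriv (fps_of_poly C) = sum D S * fps_of_poly C"
    unfolding F by (simp add: mult.left_commute)
  moreover have "sum D S = Abs_fps (\<lambda>n. if n = 0 then 0 else - (\<Sum>b\<in>S. of_nat (order b C) * inverse b ^ n))"
    by (rule fps_ext) (simp add: fps_sum_nth D_def fps_of_nat fps_mult_left_const_nth sum_negf flip: fps_of_nat)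
  ultimately show ?thesis unfolding S_def by simp
qed

text \<open>Pull the factor -b out of each x - b: together with the leading coefficient these
  constants collect to the value at 0, which is 1.\<close>

lemma complex_poly_eq_prod_roots:
  fixes C :: "complex poly"
  assumes "poly C 0 = 1"
  shows "poly C x = (\<Prod>b | poly C b = 0. (1 - x / b) ^ order b C)"
proof -
  let ?S = "{b. poly C b = 0}"
  have dec: "poly C x = lead_coeff C * (\<Prod>b\<in>?S. (x - b) ^ order b C)" for x
    by (subst complex_poly_decompose[symmetric]) (simp add: poly_prod poly_power)
  have "(\<Prod>b\<in>?S. (x - b) ^ order b C) = (\<Prod>b\<in>?S. (1 - x / b) ^ order b C * (0 - b) ^ order b C)"
  proof (intro prod.cong refl)
    fix b assume "b \<in> ?S"
    hence "b \<noteq> 0" using assms by auto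
    hence "x - b = (1 - x / b) * (0 - b)" by (simp add: field_simps)
    thus "(x - b) ^ order b C = (1 - x / b) ^ order b C * (0 - b) ^ order b C"
      by (metis power_mult_distrib)
  qed
  hence "poly C x = (\<Prod>b\<in>?S. (1 - x / b) ^ order b C) * (lead_coeff C * (\<Prod>b\<in>?S. (0 - b) ^ order b C))"
    unfolding dec[of x] by (simp add: prod.distrib)
  also have "lead_coeff C * (\<Prod>b\<in>?S. (0 - b) ^ order b C) = 1" using dec[of 0] assms by simp
  finally show ?thesis by simp
qed

text \<open>The cutoff at \<open>degree R\<close> loses nothing for a nonprincipal character, by
  \<open>Lcoeff_eq_0\<close>.\<close>

definition Lpoly :: "'a::{finite,field} poly \<Rightarrow> ('a poly \<Rightarrow> complex) \<Rightarrow> complex poly" where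
  "Lpoly R chi = (\<Sum>n<degree R. monom (Lcoeff chi n) n)"

section \<open>The L-function of a primitive character as a polynomial in q^(-s), and its
  roots\<close>

context
  fixes R :: "'a::{finite,field} poly" and chi and lq :: real
  assumes prim: "primitive_char R chi" and R1: "R \<noteq> 1"
  defines "lq \<equiv> ln (real CARD('a))"
begin

lemma primitive_char_imp_dirichlet_char: "dirichlet_char R chi" using prim by (simp add: primitive_char_def)

lemma coeff_Lpoly: "coeff (Lpoly R chi) n = Lcoeff chi n"
proof -
  obtain B where "coprime B R" "chi B \<noteq> 1" using primitive_char_nonprincipal[OF prim R1] .
  thus ?thesis using Lcoeff_eq_0[OF primitive_char_imp_dirichlet_char, of B n]
    by (auto simp: Lpoly_def coeff_sum if_distrib[of "\<lambda>x. _ x"] cong: if_cong)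
qed

lemma poly_Lpoly_0: "poly (Lpoly R chi) 0 = 1"
  unfolding poly_0_coeff_0 coeff_Lpoly by (rule Lcoeff_0[OF primitive_char_imp_dirichlet_char])

lemma Lfun_eq_poly: "Lfun chi s = poly (Lpoly R chi) (exp (- s * of_real lq))"
proof -
  have "Lfun chi s = (\<Sum>n. coeff (Lpoly R chi) n * exp (- s * of_real lq) ^ n)"
    unfolding Lfun_def coeff_Lpoly Lcoeff_def lq_def
    by (intro suminf_cong) (simp add: exp_of_nat_mult[symmetric] mult_ac)
  also have "\<dots> = (\<Sum>n\<le>degree (Lpoly R chi). coeff (Lpoly R chi) n * exp (- s * of_real lq) ^ n)"
    by (intro suminf_finite) (auto simp: coeff_eq_0)
  finally show ?thesis by (simp add: poly_altdef)
qed

lemma card_field_gt_1: "real CARD('a) > 1"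
proof -
  have "card {0, 1 :: 'a} \<le> CARD('a)" by (intro card_mono) auto
  thus ?thesis by simp
qed

lemma lq_pos: "lq > 0" using card_field_gt_1 by (simp add: lq_def)

text \<open>Both sides come from x C'/C: the recurrence expresses it by \<open>Mcoeff\<close>, the
  factorisation by power sums of inverse roots. The nonzero series C is then cancelled.\<close>

lemma Mcoeff_eq:
  assumes "n \<ge> 1"
  shows "Mcoeff chi n = - of_real lq * (\<Sum>b | poly (Lpoly R chi) b = 0. of_nat (order b (Lpoly R chi)) * inverse b ^ n)"
proof -
  let ?C = "fps_of_poly (Lpoly R chi)"
  let ?D = "Abs_fps (\<lambda>n. if n = 0 then 0 else - (\<Sum>b | poly (Lpoly R chi) b = 0. of_nat (order b (Lpoly R chi)) * inverse b ^ n))"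
  have "fps_const (of_real lq) * (fps_X * fps_deriv ?C) = Abs_fps (Mcoeff chi) * ?C"
  proof (rule fps_ext)
    fix n
    have "fps_nth (fps_X * fps_deriv ?C) n = of_nat n * Lcoeff chi n"
      by (cases n) (simp_all add: coeff_Lpoly)
    moreover have "fps_nth (Abs_fps (Mcoeff chi) * ?C) n = (\<Sum>j\<le>n. Mcoeff chi j * Lcoeff chi (n - j))"
      by (simp add: fps_mult_nth coeff_Lpoly atLeast0AtMost)
    ultimately show "fps_nth (fps_const (of_real lq) * (fps_X * fps_deriv ?C)) n = fps_nth (Abs_fps (Mcoeff chi) * ?C) n"
      using Lcoeff_recurrence[OF primitive_char_imp_dirichlet_char, of n] by (simp only: lq_def fps_mult_left_const_nth) (simp add: mult_ac)
  qed
  moreover have "fps_X * fps_deriv ?C = ?D * ?C"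
    using poly_Lpoly_0 by (intro fps_log_deriv_poly) simp
  ultimately have "(fps_const (of_real lq) * ?D) * ?C = Abs_fps (Mcoeff chi) * ?C"
    by (simp add: mult.assoc)
  moreover have "?C \<noteq> 0" using poly_Lpoly_0 by (metis fps_of_poly_0 fps_of_poly_eq_iff poly_0 zero_neq_one)
  ultimately have "fps_const (of_real lq) * ?D = Abs_fps (Mcoeff chi)" by simp
  hence "fps_nth (fps_const (of_real lq) * ?D) n = fps_nth (Abs_fps (Mcoeff chi)) n" by (rule arg_cong)
  thus ?thesis using assms by simp
qed

lemma PX_eq: "PX X chi s = exp (\<Sum>n=1..X. Mcoeff chi n * exp (- s * of_real lq) ^ n / (of_nat n * of_real lq))"
proof -
  let ?m = "\<lambda>n. {A :: 'a poly. monic_poly A \<and> degree A = n}"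
  let ?f = "\<lambda>A. chi A * of_real (mangoldt_poly A) / (exp (s * of_real (ln (pabs A))) * of_real (ln (pabs A)))"
  have "{A :: 'a poly. monic_poly A \<and> degree A \<le> X} = (\<Union>n\<in>{..X}. ?m n)" by auto
  hence "(\<Sum>A | monic_poly A \<and> degree A \<le> X. ?f A) = (\<Sum>n\<le>X. \<Sum>A\<in>?m n. ?f A)"
    by (simp only:) (intro sum.UNION_disjoint, auto simp: finite_monic_degree_eq)
  also have "\<dots> = (\<Sum>n\<le>X. Mcoeff chi n * exp (- s * of_real lq) ^ n / (of_nat n * of_real lq))"
    unfolding Mcoeff_def sum_divide_distrib sum_distrib_right
    by (intro sum.cong refl)
       (auto simp: ln_pabs lq_def exp_minus field_simps exp_of_nat_mult[symmetric])
  \<comment> \<open>The term n = 0 has denominator 0, so it is 0 by the convention for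
    division.\<close>
  also have "\<dots> = (\<Sum>n=1..X. Mcoeff chi n * exp (- s * of_real lq) ^ n / (of_nat n * of_real lq))"
    by (rule sum.mono_neutral_right) auto
  finally show ?thesis unfolding PX_def by simp
qed

text \<open>By \<open>Mcoeff_eq\<close> the exponential factors multiply to the inverse of
  \<open>PX X chi s\<close>; what remains is L as the product over its roots.\<close>

lemma Lfun_eq_PX_prod:
  "Lfun chi s = PX X chi s * (\<Prod>b | poly (Lpoly R chi) b = 0.
     ((1 - exp (- s * of_real lq) / b) * exp (\<Sum>n=1..X. (exp (- s * of_real lq) / b) ^ n / of_nat n)) ^ order b (Lpoly R chi))"
proof -
  let ?C = "Lpoly R chi" and ?x = "exp (- s * of_real lq)"
  have fin: "finite {b. poly ?C b = 0}" using poly_Lpoly_0 by (intro poly_roots_finite) auto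
  have "(\<Sum>n=1..X. Mcoeff chi n * ?x ^ n / (of_nat n * of_real lq)) =
        (\<Sum>n=1..X. - (\<Sum>b | poly ?C b = 0. of_nat (order b ?C) * ((?x / b) ^ n / of_nat n)))"
    using lq_pos by (intro sum.cong refl, subst Mcoeff_eq)
      (auto simp: field_simps sum_distrib_left sum_divide_distrib power_divide sum_distrib_right sum_negf intro!: sum.cong)
  also have "\<dots> = - (\<Sum>b | poly ?C b = 0. of_nat (order b ?C) * (\<Sum>n=1..X. (?x / b) ^ n / of_nat n))"
    by (simp only: sum_negf sum_distrib_left, subst sum.swap, simp)
  finally have PX: "PX X chi s = exp (- (\<Sum>b | poly ?C b = 0. of_nat (order b ?C) * (\<Sum>n=1..X. (?x / b) ^ n / of_nat n)))"
    by (simp add: PX_eq)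
  have "(\<Prod>b | poly ?C b = 0. exp (\<Sum>n=1..X. (?x / b) ^ n / of_nat n) ^ order b ?C) =
        exp (\<Sum>b | poly ?C b = 0. of_nat (order b ?C) * (\<Sum>n=1..X. (?x / b) ^ n / of_nat n))"
    using fin by (simp add: exp_sum exp_of_nat_mult)
  hence "PX X chi s * (\<Prod>b | poly ?C b = 0. exp (\<Sum>n=1..X. (?x / b) ^ n / of_nat n) ^ order b ?C) = 1"
    by (simp add: PX exp_minus)
  moreover have "Lfun chi s = (\<Prod>b | poly ?C b = 0. (1 - ?x / b) ^ order b ?C)"
    unfolding Lfun_eq_poly by (rule complex_poly_eq_prod_roots[OF poly_Lpoly_0])
  ultimately show ?thesis
    by (simp only: power_mult_distrib prod.distrib mult.left_commute[of "PX X chi s"] mult_1_right)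
qed

text \<open>L is the polynomial composed with g(s) = exp (-s log q), whose derivative never
  vanishes. So g takes each value to first order, and the order of the composite is that of the
  polynomial root.\<close>

lemma zorder_Lfun:
  assumes "Lfun chi \<rho> = 0"
  shows "zorder (Lfun chi) \<rho> = order (exp (- \<rho> * of_real lq)) (Lpoly R chi)"
proof -
  let ?C = "Lpoly R chi"
  define g where "g = (\<lambda>s. exp (- s * complex_of_real lq))"
  have C0: "?C \<noteq> 0" using poly_Lpoly_0 by auto
  have an: "poly ?C analytic_on {g \<rho>}" by (rule analytic_on_subset[of _ UNIV]) (auto simp: analytic_on_open intro!: holomorphic_intros)
  have holg: "g holomorphic_on UNIV" unfolding g_def by (intro holomorphic_intros)
  have ang: "g analytic_on {\<rho>}" unfolding g_def by (intro analytic_intros)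
  have der: "(g has_field_derivative - of_real lq * g \<rho>) (at \<rho>)"
    unfolding g_def by (auto intro!: derivative_eq_intros)
  have dnz: "- of_real lq * g \<rho> \<noteq> 0" using lq_pos by (simp add: g_def)
  have "open (- ({b. poly ?C b = 0} - {g \<rho>}))"
    using C0 by (intro open_Compl finite_imp_closed finite_Diff poly_roots_finite)
  hence "eventually (\<lambda>w. w \<in> - ({b. poly ?C b = 0} - {g \<rho>}) - {g \<rho>}) (at (g \<rho>))"
    by (rule eventually_at_in_open) simp
  hence ev1: "eventually (\<lambda>w. poly ?C w \<noteq> 0) (at (g \<rho>))" by eventually_elim auto
  have ev2: "eventually (\<lambda>w. g w \<noteq> g \<rho>) (at \<rho>)"
  proof -
    obtain r where r: "r > 0" "inj_on g (ball \<rho> r)"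
      using has_complex_derivative_locally_injective[of g UNIV \<rho>] dnz
      by (auto simp: DERIV_imp_deriv[OF der] holg)
    have "eventually (\<lambda>w. w \<in> ball \<rho> r - {\<rho>}) (at \<rho>)"
      using r by (intro eventually_at_in_open) auto
    thus ?thesis by eventually_elim (use r in \<open>auto simp: inj_on_def\<close>)
  qed
  have "zorder (Lfun chi) \<rho> = zorder (poly ?C \<circ> g) \<rho>"
    by (intro arg_cong2[where f = zorder] refl ext) (simp add: Lfun_eq_poly g_def)
  also have "\<dots> = zorder (poly ?C) (g \<rho>) * zorder (\<lambda>x. g x - g \<rho>) \<rho>"
    using an ang ev1 ev2 by (intro zorder_compose')
      (auto intro: isolated_singularity_at_analytic not_essential_analytic)
  \<comment> \<open>The holomorphic cofactor is the difference quotient, extended at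
    \<open>\<rho>\<close> by the derivative, which is nonzero.\<close>
  also have "zorder (\<lambda>x. g x - g \<rho>) \<rho> = 1"
  proof (rule simple_zeroI[of UNIV])
    show "(\<lambda>w. if w = \<rho> then deriv g \<rho> else (g w - g \<rho>) / (w - \<rho>)) holomorphic_on UNIV"
      by (intro pole_lemma holg) auto
  qed (use dnz in \<open>auto simp: DERIV_imp_deriv[OF der]\<close>)
  also have "zorder (poly ?C) (g \<rho>) = order (g \<rho>) ?C"
  proof -
    obtain Q where Q: "?C = [:- g \<rho>, 1:] ^ order (g \<rho>) ?C * Q" "\<not> [:- g \<rho>, 1:] dvd Q"
      using order_decomp[OF C0] by blast
    show ?thesis
    proof (rule zorder_eqI[of UNIV])
      show "poly Q (g \<rho>) \<noteq> 0" using Q(2) by (simp add: poly_eq_0_iff_dvd)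
      show "poly ?C w = poly Q w * (w - g \<rho>) powi int (order (g \<rho>) ?C)" for w
        by (subst Q(1)) (simp add: poly_power power_int_of_nat)
    qed (auto intro!: holomorphic_intros)
  qed
  finally show ?thesis by (simp add: g_def)
qed

end

section \<open>Pointwise convergence of Fourier series\<close>

definition fourier_char :: "int \<Rightarrow> real \<Rightarrow> complex" where
  "fourier_char k t = exp (2 * of_real pi * \<i> * of_int k * of_real t)"

lemma norm_fourier_char [simp]: "norm (fourier_char k t) = 1"
  by (simp add: fourier_char_def)

lemma fourier_char_0_left [simp]: "fourier_char 0 t = 1"
  by (simp add: fourier_char_def)

lemma fourier_char_0_right [simp]: "fourier_char k 0 = 1"
  by (simp add: fourier_char_def)

lemma fourier_char_add: "fourier_char (j + k) t = fourier_char j t * fourier_char k t"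
  by (simp add: fourier_char_def exp_add[symmetric] algebra_simps)

lemma fourier_char_add_right: "fourier_char k (s + t) = fourier_char k s * fourier_char k t"
  by (simp add: fourier_char_def exp_add[symmetric] algebra_simps)

lemma fourier_char_eq_1:
  assumes "of_int k * t \<in> \<int>"
  shows "fourier_char k t = 1"
proof -
  obtain m where "of_int k * t = of_int m" using assms by (elim Ints_cases)
  hence "of_int k * of_real t = (of_int m :: complex)" by (metis of_real_mult of_real_of_int_eq)
  hence "fourier_char k t = exp (2 * of_real pi * \<i> * of_int m)"
    unfolding fourier_char_def by (simp add: mult.assoc)
  also have "\<dots> = 1" by (auto simp: exp_eq_1 intro: exI[of _ m])
  finally show ?thesis .
qed

lemma continuous_on_fourier_char [continuous_intros]: "continuous_on A (fourier_char k)"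
  unfolding fourier_char_def by (intro continuous_intros)

lemma fourier_char_has_vector_derivative:
  "(fourier_char k has_vector_derivative 2 * of_real pi * \<i> * of_int k * fourier_char k t) (at t within A)"
proof -
  have "((\<lambda>x. exp (2 * of_real pi * \<i> * of_int k * x)) has_field_derivative
         2 * of_real pi * \<i> * of_int k * fourier_char k t) (at (of_real t))"
    unfolding fourier_char_def by (auto intro!: derivative_eq_intros)
  from has_vector_derivative_real_field[OF this] show ?thesis
    unfolding fourier_char_def by (simp add: o_def)
qed

lemma integral_fourier_char_period:
  assumes "k \<noteq> 0" "a \<le> b" "of_int k * (b - a) \<in> \<int>"
  shows "integral {a..b} (fourier_char k) = 0"
proof -
  let ?c = "2 * of_real pi * \<i> * of_int k :: complex"
  have c: "?c \<noteq> 0" using assms by simp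
  have "((\<lambda>t. ?c * fourier_char k t) has_integral fourier_char k b - fourier_char k a) {a..b}"
    using assms(2) fourier_char_has_vector_derivative by (intro fundamental_theorem_of_calculus)
  moreover have "fourier_char k b = fourier_char k a"
    using fourier_char_add_right[of k a "b - a"] fourier_char_eq_1[OF assms(3)] by simp
  ultimately have "integral {a..b} (\<lambda>t. ?c * fourier_char k t) = 0"
    by (intro integral_unique) simp
  thus ?thesis using c by simp
qed

lemma integral_fourier_char: "integral {0..1} (fourier_char k) = (if k = 0 then 1 else 0)"
proof (cases "k = 0")
  case True
  have "integral {0..1} (fourier_char 0) = integral {0..1} (\<lambda>_::real. 1 :: complex)"
    by (rule Henstock_Kurzweil_Integration.integral_cong) simp
  also have "\<dots> = 1" by simp
  finally show ?thesis using True by simp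
next
  case False
  thus ?thesis using integral_fourier_char_period[of k 0 1] by simp
qed

text \<open>Cut the unit interval into n = |k| pieces, each a full period of the character. On a
  piece the character integrates to 0, so \<open>\<psi>\<close> may be replaced by its difference
  from the value at the left endpoint, which is at most e in norm.\<close>

lemma norm_fourier_coeff_le:
  fixes \<psi> :: "real \<Rightarrow> complex"
  assumes cont: "continuous_on {0..1} \<psi>" and k: "nat \<bar>k\<bar> = n" "n > 0"
    and osc: "\<And>s t. s \<in> {0..1} \<Longrightarrow> t \<in> {0..1} \<Longrightarrow> \<bar>s - t\<bar> \<le> 1 / n \<Longrightarrow> norm (\<psi> s - \<psi> t) \<le> e"
  shows "norm (integral {0..1} (\<lambda>t. \<psi> t * fourier_char k t)) \<le> e"
proof -
  have *: "norm (integral {0..j / n} (\<lambda>t. \<psi> t * fourier_char k t)) \<le> e * (j / n)" if "j \<le> n" for j :: nat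
    using that
  proof (induction j)
    case (Suc j)
    let ?a = "real j / n" and ?b = "real (Suc j) / n"
    have ab: "0 \<le> ?a" "?a \<le> ?b" "?b \<le> 1" "?b - ?a = 1 / n"
      using Suc.prems k by (auto simp: field_simps)
    have sub: "{?a..?b} \<subseteq> {0..1}" "{0..?b} \<subseteq> {0..1}"
      using ab(1,3) by (auto simp del: of_nat_Suc intro: order_trans)
    have contab: "continuous_on {?a..?b} (\<lambda>t. \<psi> t * fourier_char k t)"
      "continuous_on {0..?b} (\<lambda>t. \<psi> t * fourier_char k t)"
      "continuous_on {?a..?b} \<psi>"
      by (intro continuous_intros continuous_on_subset[OF cont] sub)+
    have zero: "integral {?a..?b} (fourier_char k) = 0"
    proof (rule integral_fourier_char_period)
      have "real_of_int k * (1 / n) = sgn k" using k by (cases "k \<ge> 0") (auto simp: field_simps sgn_if)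
      thus "real_of_int k * (?b - ?a) \<in> \<int>" unfolding ab by simp
    qed (use k ab in auto)
    have "integral {?a..?b} (\<lambda>t. \<psi> t * fourier_char k t) =
          integral {?a..?b} (\<lambda>t. (\<psi> t - \<psi> ?a) * fourier_char k t + \<psi> ?a * fourier_char k t)"
      by (simp add: algebra_simps)
    also have "\<dots> = integral {?a..?b} (\<lambda>t. (\<psi> t - \<psi> ?a) * fourier_char k t)"
      using contab zero by (subst integral_add) (auto intro!: integrable_continuous_real continuous_intros)
    also have "norm \<dots> \<le> e * (?b - ?a)"
    proof (rule integral_bound)
      fix t assume "t \<in> {?a..?b}"
      hence "t \<in> {0..1}" "?a \<in> {0..1}" "\<bar>t - ?a\<bar> \<le> 1 / n"
        using sub(1) ab by (blast, simp, auto simp del: of_nat_Suc)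
      hence "norm (\<psi> t - \<psi> ?a) \<le> e" by (rule osc)
      thus "norm ((\<psi> t - \<psi> ?a) * fourier_char k t) \<le> e" by (simp add: norm_mult)
    qed (use contab ab in \<open>auto intro!: continuous_intros\<close>)
    finally have 1: "norm (integral {?a..?b} (\<lambda>t. \<psi> t * fourier_char k t)) \<le> e * (?b - ?a)" .
    have "integral {0..?a} (\<lambda>t. \<psi> t * fourier_char k t) + integral {?a..?b} (\<lambda>t. \<psi> t * fourier_char k t) =
          integral {0..?b} (\<lambda>t. \<psi> t * fourier_char k t)"
      using ab contab by (intro Henstock_Kurzweil_Integration.integral_combine integrable_continuous_real) auto
    hence "norm (integral {0..?b} (\<lambda>t. \<psi> t * fourier_char k t)) \<le> e * ?a + e * (?b - ?a)"
      using norm_triangle_mono[OF Suc.IH 1] Suc.prems by simp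
    thus ?case by (simp add: algebra_simps)
  qed simp
  show ?thesis using *[of n] k by simp
qed

text \<open>Uniform continuity makes the oscillation on pieces of length 1/|k| arbitrarily
  small.\<close>

lemma riemann_lebesgue:
  fixes \<psi> :: "real \<Rightarrow> complex" and k :: "nat \<Rightarrow> int"
  assumes "continuous_on {0..1} \<psi>" "filterlim (\<lambda>n. nat \<bar>k n\<bar>) at_top at_top"
  shows "(\<lambda>n. integral {0..1} (\<lambda>t. \<psi> t * fourier_char (k n) t)) \<longlonglongrightarrow> 0"
proof (rule tendstoI)
  fix e :: real assume e: "e > 0"
  have "uniformly_continuous_on {0..1} \<psi>" using assms(1) by (intro compact_uniformly_continuous) auto
  then obtain d where d: "d > 0" "\<And>s t. s \<in> {0..1} \<Longrightarrow> t \<in> {0..1} \<Longrightarrow> dist s t < d \<Longrightarrow> dist (\<psi> s) (\<psi> t) < e / 2"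
    using e unfolding uniformly_continuous_on_def by (metis dist_commute half_gt_zero)
  have "eventually (\<lambda>n. nat \<bar>k n\<bar> \<ge> Suc (nat \<lceil>1 / d\<rceil>)) at_top"
    using assms(2) unfolding filterlim_at_top by blast
  thus "eventually (\<lambda>n. dist (integral {0..1} (\<lambda>t. \<psi> t * fourier_char (k n) t)) 0 < e) at_top"
  proof eventually_elim
    case (elim n)
    have "1 / d < real (nat \<bar>k n\<bar>)" using elim by linarith
    hence "1 / real (nat \<bar>k n\<bar>) < d" using d(1) elim by (simp add: field_simps)
    have "norm (integral {0..1} (\<lambda>t. \<psi> t * fourier_char (k n) t)) \<le> e / 2"
    proof (rule norm_fourier_coeff_le[OF assms(1) refl])
      fix s t :: real
      assume "s \<in> {0..1}" "t \<in> {0..1}" "\<bar>s - t\<bar> \<le> 1 / real (nat \<bar>k n\<bar>)"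
      moreover from this have "dist s t < d"
        using \<open>1 / real (nat \<bar>k n\<bar>) < d\<close> by (simp add: dist_real_def)
      ultimately show "norm (\<psi> s - \<psi> t) \<le> e / 2" using d(2)[of s t] by (simp add: dist_norm)
    qed (use elim in simp)
    thus ?case using e by simp
  qed
qed

text \<open>As limits of quotients, two derivatives can be divided by each other, as in l'Hopital's
  rule at the ends of the period.\<close>

lemma has_vector_derivative_difference_quotient:
  assumes "(f has_vector_derivative D) (at x within A)"
  shows "((\<lambda>t. (f t - f x) /\<^sub>R (t - x)) \<longlongrightarrow> D) (at x within A)"
proof -
  have "((\<lambda>t. norm ((f t - f x) - (t - x) *\<^sub>R D) / norm (t - x)) \<longlongrightarrow> 0) (at x within A)"
    using assms by (simp add: has_vector_derivative_def has_derivative_iff_norm)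
  moreover have "eventually (\<lambda>t. norm ((f t - f x) - (t - x) *\<^sub>R D) / norm (t - x) =
                                 norm ((f t - f x) /\<^sub>R (t - x) - D)) (at x within A)"
    unfolding eventually_at_filter
  proof (intro always_eventually allI impI)
    fix t assume "t \<noteq> x"
    hence "(f t - f x) /\<^sub>R (t - x) - D = ((f t - f x) - (t - x) *\<^sub>R D) /\<^sub>R (t - x)"
      by (simp add: scaleR_diff_right)
    thus "norm ((f t - f x) - (t - x) *\<^sub>R D) / norm (t - x) = norm ((f t - f x) /\<^sub>R (t - x) - D)"
      by (simp add: divide_inverse mult.commute)
  qed
  ultimately have "((\<lambda>t. norm ((f t - f x) /\<^sub>R (t - x) - D)) \<longlongrightarrow> 0) (at x within A)"
    by (rule Lim_transform_eventually)
  thus ?thesis by (rule LIM_zero_cancel[OF tendsto_norm_zero_cancel])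
qed

lemma fourier_char_1_eq_1_iff:
  assumes "t \<in> {0..1}"
  shows "fourier_char 1 t = 1 \<longleftrightarrow> t = 0 \<or> t = 1"
proof
  assume "fourier_char 1 t = 1"
  then obtain n where "2 * pi * t = of_int (2 * n) * pi"
    by (auto simp: fourier_char_def exp_eq_1)
  hence "t = of_int n" by simp
  thus "t = 0 \<or> t = 1" using assms by auto
qed (auto intro: fourier_char_eq_1)

text \<open>Chernoff's argument: dividing \<open>\<phi> - \<phi> 0\<close> by \<open>fourier_char 1 - 1\<close> makes the partial sums telescope.\<close>
lemma fourier_sum_at_0:
  fixes \<phi> :: "real \<Rightarrow> complex"
  assumes cont: "continuous_on {0..1} \<phi>" and per: "\<phi> 1 = \<phi> 0"
    and d0: "(\<phi> has_vector_derivative D0) (at 0 within {0..1})"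
    and d1: "(\<phi> has_vector_derivative D1) (at 1 within {0..1})"
  shows "(\<lambda>N::nat. \<Sum>k = -int N..int N. integral {0..1} (\<lambda>t. \<phi> t * fourier_char k t)) \<longlonglongrightarrow> \<phi> 0"
proof -
  \<comment> \<open>At the endpoints the quotient is 0/0; the values are its one-sided limits, as
    \<open>fourier_char 1\<close> has derivative 2 pi i there. The one-sided derivatives of
    \<open>\<phi>\<close> at the two ends may differ.\<close>
  define \<psi> where "\<psi> = (\<lambda>t. if t = 0 then D0 / (2 * of_real pi * \<i>) else if t = 1 then D1 / (2 * of_real pi * \<i>)
     else (\<phi> t - \<phi> 0) / (fourier_char 1 t - 1))"
  have lim: "((\<lambda>t. (\<phi> t - \<phi> 0) / (fourier_char 1 t - 1)) \<longlongrightarrow> D / (2 * of_real pi * \<i>)) (at x within {0..1})"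
    if D: "(\<phi> has_vector_derivative D) (at x within {0..1})" and x: "\<phi> x = \<phi> 0" "fourier_char 1 x = 1" for x D
  proof -
    have "((\<lambda>t. ((\<phi> t - \<phi> x) /\<^sub>R (t - x)) / ((fourier_char 1 t - fourier_char 1 x) /\<^sub>R (t - x)))
            \<longlongrightarrow> D / (2 * of_real pi * \<i> * of_int 1 * fourier_char 1 x)) (at x within {0..1})"
      using x by (intro tendsto_divide has_vector_derivative_difference_quotient D fourier_char_has_vector_derivative) simp
    hence "((\<lambda>t. ((\<phi> t - \<phi> x) /\<^sub>R (t - x)) / ((fourier_char 1 t - fourier_char 1 x) /\<^sub>R (t - x)))
            \<longlongrightarrow> D / (2 * of_real pi * \<i>)) (at x within {0..1})" by (simp add: x)
    moreover have "eventually (\<lambda>t. ((\<phi> t - \<phi> x) /\<^sub>R (t - x)) / ((fourier_char 1 t - fourier_char 1 x) /\<^sub>R (t - x)) =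
        (\<phi> t - \<phi> 0) / (fourier_char 1 t - 1)) (at x within {0..1})"
      unfolding eventually_at_filter by (intro always_eventually) (auto simp: x scaleR_conv_of_real)
    ultimately show ?thesis by (rule Lim_transform_eventually)
  qed
  have psi: "\<phi> t - \<phi> 0 = \<psi> t * (fourier_char 1 t - 1)" if "t \<in> {0..1}" for t
    using that fourier_char_1_eq_1_iff[OF that] per by (auto simp: \<psi>_def)
  have cpsi: "continuous_on {0..1} \<psi>"
    unfolding continuous_on_def
  proof
    fix x :: real assume x: "x \<in> {0..1}"
    let ?q = "\<lambda>t. (\<phi> t - \<phi> 0) / (fourier_char 1 t - 1)"
    have ev: "eventually (\<lambda>t. ?q t = \<psi> t) (at x within {0..1})"
    proof -
      have "open (- ({0, 1} - {x}))" by (intro open_Compl finite_imp_closed) auto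
      hence "eventually (\<lambda>t. t \<in> - ({0, 1} - {x}) - {x}) (at x)"
        by (rule eventually_at_in_open) auto
      moreover have "at x within {0..1} \<le> at x" by (rule at_le) simp
      ultimately have "eventually (\<lambda>t. t \<in> - ({0, 1} - {x}) - {x}) (at x within {0..1})"
        by (rule filter_leD[rotated])
      thus ?thesis by eventually_elim (auto simp: \<psi>_def)
    qed
    have "(?q \<longlongrightarrow> \<psi> x) (at x within {0..1})"
    proof (cases "x = 0 \<or> x = 1")
      case True
      thus ?thesis
      proof
        assume "x = 0"
        moreover have "\<psi> 0 = D0 / (2 * of_real pi * \<i>)" by (simp add: \<psi>_def)
        moreover have "(?q \<longlongrightarrow> D0 / (2 * of_real pi * \<i>)) (at 0 within {0..1})" by (rule lim[OF d0]) auto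
        ultimately show ?thesis by (simp only:)
      next
        assume "x = 1"
        moreover have "\<psi> 1 = D1 / (2 * of_real pi * \<i>)" by (simp add: \<psi>_def)
        moreover have "(?q \<longlongrightarrow> D1 / (2 * of_real pi * \<i>)) (at 1 within {0..1})"
          by (rule lim[OF d1]) (auto simp: per fourier_char_eq_1)
        ultimately show ?thesis by (simp only:)
      qed
    next
      case False
      hence nz: "fourier_char 1 x - 1 \<noteq> 0" using fourier_char_1_eq_1_iff[OF x] by simp
      have "(\<phi> \<longlongrightarrow> \<phi> x) (at x within {0..1})" "(fourier_char 1 \<longlongrightarrow> fourier_char 1 x) (at x within {0..1})"
        using cont continuous_on_fourier_char[of "{0..1}" 1] x by (auto simp: continuous_on_def)
      hence "(?q \<longlongrightarrow> ?q x) (at x within {0..1})" using nz by (intro tendsto_intros)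
      thus ?thesis using False by (simp add: \<psi>_def)
    qed
    thus "(\<psi> \<longlongrightarrow> \<psi> x) (at x within {0..1})" using ev by (rule Lim_transform_eventually)
  qed
  define a where "a = (\<lambda>k. integral {0..1} (\<lambda>t. \<psi> t * fourier_char k t))"
  \<comment> \<open>Multiplying by \<open>fourier_char 1 t - 1\<close> shifts the index of the
    character, so apart from the constant \<open>\<phi> 0\<close> each coefficient is a difference
    of neighbouring values of \<open>a\<close>.\<close>
  have coeff: "integral {0..1} (\<lambda>t. \<phi> t * fourier_char k t) = (if k = 0 then \<phi> 0 else 0) + (a (k + 1) - a k)" for k
  proof -
    have "integral {0..1} (\<lambda>t. \<phi> t * fourier_char k t) =
          integral {0..1} (\<lambda>t. \<phi> 0 * fourier_char k t + (\<psi> t * fourier_char (k + 1) t - \<psi> t * fourier_char k t))"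
    proof (rule Henstock_Kurzweil_Integration.integral_cong)
      fix t :: real assume t: "t \<in> {0..1}"
      have "\<phi> t = \<phi> 0 + \<psi> t * (fourier_char 1 t - 1)" using psi[OF t] by (simp add: algebra_simps)
      hence "\<phi> t * fourier_char k t = (\<phi> 0 + \<psi> t * (fourier_char 1 t - 1)) * fourier_char k t"
        by (rule arg_cong)
      thus "\<phi> t * fourier_char k t = \<phi> 0 * fourier_char k t + (\<psi> t * fourier_char (k + 1) t - \<psi> t * fourier_char k t)"
        by (simp add: fourier_char_add algebra_simps)
    qed
    also have "\<dots> = \<phi> 0 * integral {0..1} (fourier_char k) + (a (k + 1) - a k)"
    proof -
      have int: "(\<lambda>t. \<psi> t * fourier_char j t) integrable_on {0..1}" for j
        by (rule integrable_continuous_real, rule continuous_on_mult, rule cpsi, rule continuous_on_fourier_char)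
      have "(\<lambda>t. \<phi> 0 * fourier_char k t) integrable_on {0..1}"
        by (intro integrable_continuous_real continuous_intros)
      thus ?thesis by (simp add: integral_add integral_diff int integrable_diff a_def)
    qed
    also note integral_fourier_char
    finally show ?thesis by simp
  qed
  define c where "c = (\<lambda>k. integral {0..1} (\<lambda>t. \<phi> t * fourier_char k t))"
  have c: "c k = (if k = 0 then \<phi> 0 else 0) + (a (k + 1) - a k)" for k
    unfolding c_def by (rule coeff)
  have sum: "(\<Sum>k = -int N..int N. c k) = \<phi> 0 + (a (int N + 1) - a (- int N))" for N
  proof (induction N)
    case 0 thus ?case by (simp add: c)
  next
    case (Suc N)
    let ?m = "int N + 1"
    have "{-int (Suc N)..int (Suc N)} = insert (- ?m) (insert ?m {-int N..int N})" by auto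
    hence "(\<Sum>k = -int (Suc N)..int (Suc N). c k) = c (- ?m) + (c ?m + (\<Sum>k = -int N..int N. c k))"
      by (simp only:) (subst sum.insert, simp, simp, subst sum.insert, simp_all)
    also have "\<dots> = \<phi> 0 + (a (?m + 1) - a (- ?m))"
      using Suc.IH c[of ?m] c[of "- ?m"] by simp
    finally show ?case by (simp add: add.commute)
  qed
  \<comment> \<open>The two boundary terms left by telescoping vanish in the limit by
    \<open>riemann_lebesgue\<close>.\<close>
  have "(\<lambda>n. nat \<bar>int n + 1\<bar>) = Suc" by (rule ext) arith
  hence "(\<lambda>N. a (int N + 1)) \<longlonglongrightarrow> 0" unfolding a_def
    by (intro riemann_lebesgue[OF cpsi]) (simp add: filterlim_Suc)
  moreover have "(\<lambda>N. a (- int N)) \<longlonglongrightarrow> 0" unfolding a_def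
    by (rule riemann_lebesgue[OF cpsi]) (simp add: filterlim_ident)
  ultimately have "(\<lambda>N. \<phi> 0 + (a (int N + 1) - a (- int N))) \<longlonglongrightarrow> \<phi> 0 + (0 - 0)"
    by (intro tendsto_intros)
  hence "(\<lambda>N. \<Sum>k = -int N..int N. c k) \<longlonglongrightarrow> \<phi> 0" by (simp add: sum)
  thus ?thesis unfolding c_def .
qed

section \<open>The Laplace transform of a bump function\<close>

text \<open>If \<open>w\<close> is (s - \<rho>) log q for one zero \<rho>, these are the same
  quantities for all zeros above the same root.\<close>

definition z_shift :: "complex \<Rightarrow> int \<Rightarrow> complex" where
  "z_shift w k = w - 2 * of_real pi * \<i> * of_int k"

lemma exp_z_shift: "exp (z_shift w k) = exp w"
proof -
  have "exp (2 * of_real pi * \<i> * of_int k) = (1::complex)"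
    by (auto simp: exp_eq_1 intro: exI[of _ k])
  thus ?thesis by (simp add: z_shift_def exp_diff)
qed

text \<open>\<open>b\<close> is the density of X * ln x - X when x has density \<open>u\<close>. The
  zero boundary values serve the integration by parts, and the mass 1 determines the jump of the
  antiderivative over one period.\<close>

locale bump =
  fixes b b' :: "real \<Rightarrow> real" and X :: nat
  assumes b_deriv: "\<And>t. (b has_real_derivative b' t) (at t)"
    and b'_cont: "continuous_on UNIV b'"
    and b_0: "b 0 = 0" and b_1: "b 1 = 0"
    and b_integral: "integral {0..1} b = 1"
    and X_pos: "X \<ge> 1"
begin

abbreviation K :: "complex \<Rightarrow> real \<Rightarrow> complex" where
  "K z t \<equiv> exp (- z * of_real (real X + t))"

definition M :: "complex \<Rightarrow> complex" where
  "M z = integral {0..1} (\<lambda>t. of_real (b t) * K z t)"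

lemma b_cont: "continuous_on A b"
  using b_deriv by (meson DERIV_continuous_on has_field_derivative_at_within)

lemma b'_cont': "continuous_on A b'"
  using b'_cont continuous_on_subset by blast

lemma K_has_vector_derivative:
  "((\<lambda>t. K z t) has_vector_derivative - z * K z t) (at t within A)"
proof -
  have "((\<lambda>t. exp (- z * (of_nat X + t))) has_field_derivative - z * K z t) (at (of_real t))"
    by (auto intro!: derivative_eq_intros)
  from has_vector_derivative_real_field[OF this] show ?thesis by simp
qed

text \<open>Integration by parts, with no boundary terms because \<open>b\<close> vanishes at 0 and
  1. This is the source of the decay of M.\<close>

lemma mult_M: "z * M z = integral {0..1} (\<lambda>t. of_real (b' t) * K z t)"
proof -
  let ?e = "K z"
  have "((\<lambda>t. of_real (b t) * (- z * ?e t) + of_real (b' t) * ?e t) has_integral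
         of_real (b 1) * ?e 1 - of_real (b 0) * ?e 0) {0..1}"
  proof (rule fundamental_theorem_of_calculus)
    fix t :: real
    have "((\<lambda>t. of_real (b t) :: complex) has_vector_derivative of_real (b' t)) (at t within {0..1})"
      by (intro has_vector_derivative_of_real DERIV_subset[OF b_deriv]) simp
    from has_vector_derivative_mult[OF this K_has_vector_derivative]
    show "((\<lambda>t. of_real (b t) * ?e t) has_vector_derivative of_real (b t) * (- z * ?e t) + of_real (b' t) * ?e t) (at t within {0..1})" .
  qed simp
  hence 1: "((\<lambda>t. of_real (b t) * (- z * ?e t) + of_real (b' t) * ?e t) has_integral 0) {0..1}"
    by (simp add: b_0 b_1)
  have "((\<lambda>t. of_real (b t) * ?e t) has_integral M z) {0..1}" unfolding M_def
    by (intro integrable_integral integrable_continuous_real continuous_intros b_cont)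
  from has_integral_mult_right[OF this, of z] 
  have "((\<lambda>t. z * (of_real (b t) * ?e t)) has_integral z * M z) {0..1}" .
  from has_integral_add[OF 1 this]
  have "((\<lambda>t. of_real (b' t) * ?e t) has_integral z * M z) {0..1}" by (simp add: algebra_simps)
  thus ?thesis by (simp add: integral_unique)
qed

definition b'_max :: real where "b'_max = (SUP t\<in>{0..1}. \<bar>b' t\<bar>)"

lemma b'_le_max: "t \<in> {0..1} \<Longrightarrow> \<bar>b' t\<bar> \<le> b'_max"
  unfolding b'_max_def
  by (intro cSUP_upper bounded_imp_bdd_above compact_imp_bounded compact_continuous_image
        continuous_intros b'_cont') auto

lemma b'_max_nonneg: "b'_max \<ge> 0"
  using b'_le_max[of 0] by simp

text \<open>Here a is the real part at the start of a ray and r the distance travelled. Since X + t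
  >= 1, the kernel decays at least like exp (-r).\<close>

lemma norm_K_le:
  assumes "Re z = a + r" "r \<ge> 0" "t \<in> {0..1}"
  shows "norm (K z t) \<le> exp (\<bar>a\<bar> * (real X + 1)) * exp (- r)"
proof -
  have "- a * (real X + t) \<le> \<bar>a\<bar> * (real X + 1)"
    using assms by (intro mult_mono) auto
  moreover have "r * 1 \<le> r * (real X + t)" using assms X_pos by (intro mult_left_mono) auto
  ultimately have "- Re z * (real X + t) \<le> \<bar>a\<bar> * (real X + 1) - r"
    by (simp add: assms(1) algebra_simps)
  thus ?thesis by (simp add: exp_add[symmetric] norm_exp_eq_Re del: of_real_add of_nat_Suc)
qed

lemma norm_mult_M_le:
  assumes "Re z = a + r" "r \<ge> 0"
  shows "norm (z * M z) \<le> b'_max * exp (\<bar>a\<bar> * (real X + 1)) * exp (- r)"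
proof -
  have "norm (z * M z) \<le> (b'_max * (exp (\<bar>a\<bar> * (real X + 1)) * exp (- r))) * (1 - 0)"
    unfolding mult_M
  proof (rule integral_bound)
    fix t :: real assume "t \<in> {0..1}"
    thus "norm (of_real (b' t) * K z t) \<le> b'_max * (exp (\<bar>a\<bar> * (real X + 1)) * exp (- r))"
      unfolding norm_mult using b'_le_max[of t] norm_K_le[OF assms] b'_max_nonneg
      by (intro mult_mono) auto
  qed (auto intro!: continuous_intros b'_cont')
  thus ?thesis by (simp add: mult.assoc)
qed

lemma continuous_on_M: "continuous_on A M"
proof -
  have "continuous_on A (\<lambda>z. integral (cbox 0 1) (\<lambda>t. of_real (b t) * K z t))"
    by (rule integral_continuous_on_param)
       (auto simp: case_prod_unfold intro!: continuous_intros continuous_on_compose2[OF b_cont[of UNIV]])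
  thus ?thesis by (simp add: M_def[abs_def])
qed

text \<open>The 1-periodic function is K times an antiderivative of \<open>b\<close>: it satisfies
  P' = b K - z P, and integrating over a period gives z * (integral of P) = M z. Its value at 0 is c
  * exp (-Xw).\<close>

lemma sum_M_z_shift:
  assumes w: "exp w \<noteq> 1"
  shows "(\<lambda>N::nat. \<Sum>k = -int N..int N. M (z_shift w k) / z_shift w k) \<longlonglongrightarrow> exp (- of_nat X * w) / (exp w - 1)"
proof -
  \<comment> \<open>The constant of integration is fixed by periodicity: (1 + c) * exp (-w) =
    c.\<close>
  define c where "c = 1 / (exp w - 1)"
  define B where "B = (\<lambda>t. integral {0..t} b)"
  have B: "((\<lambda>t. of_real (B t) + c) has_vector_derivative of_real (b t)) (at t within {0..1})"
    if "t \<in> {0..1}" for t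
  proof -
    have "(B has_vector_derivative b t) (at t within {0..1})"
      unfolding B_def using that by (intro integral_has_vector_derivative b_cont)
    hence "((\<lambda>t. of_real (B t) :: complex) has_vector_derivative of_real (b t)) (at t within {0..1})"
      by (intro has_vector_derivative_of_real) (simp add: has_real_derivative_iff_has_vector_derivative)
    from has_vector_derivative_add[OF this has_vector_derivative_const] show ?thesis by simp
  qed
  have B01: "B 0 = 0" "B 1 = 1" by (simp_all add: B_def b_integral)
  define P where "P = (\<lambda>z t. (of_real (B t) + c) * K z t)"
  have P_deriv: "(P z has_vector_derivative of_real (b t) * K z t - z * P z t) (at t within {0..1})"
    if "t \<in> {0..1}" for z t
    using has_vector_derivative_mult[OF B[OF that] K_has_vector_derivative, of z]
    by (simp add: P_def[abs_def] algebra_simps)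
  have P_cont: "continuous_on {0..1} (P z)" for z
    unfolding continuous_on_eq_continuous_within
    using P_deriv has_vector_derivative_continuous by blast
  have P_per: "P z 1 = P z 0" if "exp z = exp w" for z
  proof -
    have "exp z - 1 \<noteq> 0" using that w by simp
    moreover have "- z * of_real (real X + 1) = - z * of_real (real X + 0) - z"
      by (simp add: algebra_simps)
    hence "K z 1 = K z 0 / exp z" by (simp only: exp_diff)
    moreover have "(1 + 1 / (E - 1)) * (k / E) = 1 / (E - 1) * k" if "E - 1 \<noteq> 0" "E \<noteq> 0" for E k :: complex
      using that by (simp add: divide_simps)
    ultimately show ?thesis unfolding P_def B01 c_def that[symmetric] of_real_0 of_real_1 add_0_left
      by simp
  qed
  have coeff: "integral {0..1} (\<lambda>t. P w t * fourier_char k t) = M (z_shift w k) / z_shift w k" for k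
  proof -
    let ?z = "z_shift w k"
    have z: "exp ?z = exp w" by (rule exp_z_shift)
    hence z0: "?z \<noteq> 0" using w by auto
    have "P w t * fourier_char k t = P ?z t" for t
    proof -
      \<comment> \<open>Because X is an integer, passing from \<open>w\<close> to
        \<open>z_shift w k\<close> multiplies the kernel by exactly
        \<open>fourier_char k t\<close>.\<close>
      have "exp (2 * of_real pi * \<i> * of_int (k * int X)) = (1::complex)"
        by (auto simp: exp_eq_1 intro: exI[of _ "k * int X"])
      hence "K w t * fourier_char k t = 
             K w t * (exp (2 * of_real pi * \<i> * of_int (k * int X)) * fourier_char k t)" by simp
      also have "\<dots> = K ?z t"
        unfolding fourier_char_def exp_add[symmetric] by (simp add: z_shift_def algebra_simps)
      finally show ?thesis by (simp add: P_def mult.assoc)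
    qed
    hence "integral {0..1} (\<lambda>t. P w t * fourier_char k t) = integral {0..1} (P ?z)" by simp
    moreover have "?z * integral {0..1} (P ?z) = M ?z"
    proof -
      have "((\<lambda>t. of_real (b t) * K ?z t - ?z * P ?z t) has_integral P ?z 1 - P ?z 0) {0..1}"
        by (intro fundamental_theorem_of_calculus P_deriv) auto
      hence 1: "((\<lambda>t. of_real (b t) * K ?z t - ?z * P ?z t) has_integral 0) {0..1}"
        using P_per[OF z] by simp
      have "(P ?z has_integral integral {0..1} (P ?z)) {0..1}"
        by (intro integrable_integral integrable_continuous_real P_cont)
      from has_integral_add[OF 1 has_integral_mult_right[OF this, of ?z]]
      have "((\<lambda>t. of_real (b t) * K ?z t) has_integral ?z * integral {0..1} (P ?z)) {0..1}"
        by simp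
      thus ?thesis unfolding M_def by (simp add: integral_unique)
    qed
    ultimately show ?thesis using z0 by (simp add: field_simps)
  qed
  have "(\<lambda>N::nat. \<Sum>k = -int N..int N. integral {0..1} (\<lambda>t. P w t * fourier_char k t)) \<longlonglongrightarrow> P w 0"
    by (rule fourier_sum_at_0[OF P_cont P_per[OF refl] P_deriv P_deriv]) auto
  thus ?thesis unfolding coeff by (simp add: P_def B01 c_def mult.commute)
qed

end

section \<open>Summation along a vertical progression\<close>

text \<open>Symmetric intervals eventually contain every finite set of integers, so an unordered sum
  is also the limit of the partial sums that Fourier theory delivers.\<close>

lemma has_sum_int_imp_tendsto:
  assumes "(f has_sum S) (UNIV :: int set)"
  shows "(\<lambda>N::nat. \<Sum>k = -int N..int N. f k) \<longlonglongrightarrow> S"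
proof -
  have "filterlim (\<lambda>N. {-int N..int N}) (finite_subsets_at_top UNIV) sequentially"
    unfolding filterlim_finite_subsets_at_top
  proof safe
    fix Y :: "int set" assume "finite Y"
    hence "finite ((\<lambda>k. nat \<bar>k\<bar>) ` Y)" by simp
    then obtain N where N: "\<And>k. k \<in> Y \<Longrightarrow> nat \<bar>k\<bar> \<le> N"
      unfolding finite_nat_set_iff_bounded_le by auto
    have "Y \<subseteq> {-int n..int n}" if "n \<ge> N" for n
    proof
      fix k assume "k \<in> Y"
      hence "nat \<bar>k\<bar> \<le> n" using N that by (meson order_trans)
      thus "k \<in> {-int n..int n}" by auto
    qed
    thus "eventually (\<lambda>n. finite {-int n..int n} \<and> Y \<subseteq> {-int n..int n} \<and> {-int n..int n} \<subseteq> UNIV) sequentially"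
      by (intro eventually_sequentiallyI[of N]) simp
  qed
  thus ?thesis using assms unfolding has_sum_def by (rule filterlim_compose[rotated])
qed

lemma summable_on_int_inverse_squares: "(\<lambda>k. 1 / (real_of_int k)\<^sup>2) summable_on UNIV"
proof -
  have 1: "(\<lambda>n::nat. 1 / (real n)\<^sup>2) summable_on UNIV"
    using inverse_power_summable[of 2, where 'a = real]
    by (intro summable_nonneg_imp_summable_on) (simp_all add: inverse_eq_divide)
  have "(\<lambda>k. 1 / (real_of_int k)\<^sup>2) summable_on range int"
    using 1 by (subst summable_on_reindex) (auto simp: o_def)
  moreover have "(\<lambda>k. 1 / (real_of_int k)\<^sup>2) summable_on range (\<lambda>n. - int n)"
    using 1 by (subst summable_on_reindex) (auto simp: o_def inj_on_def)
  ultimately have "(\<lambda>k. 1 / (real_of_int k)\<^sup>2) summable_on (range int \<union> range (\<lambda>n. - int n))"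
    by (rule summable_on_union)
  moreover have "k \<in> range int \<union> range (\<lambda>n. - int n)" for k
    by (cases k rule: int_cases2) auto
  hence "range int \<union> range (\<lambda>n. - int n) = UNIV" by blast
  ultimately show ?thesis by simp
qed

lemma set_integrable_exp_neg: "set_integrable lborel {0..} (\<lambda>r::real. exp (- r))"
proof -
  have "(\<lambda>r::real. exp (- 1 * r)) absolutely_integrable_on {0..}"
    by (intro nonnegative_absolutely_integrable_1 integrable_on_exp_minus_to_infinity) auto
  moreover have "(\<lambda>r::real. indicat_real {0..} r *\<^sub>R exp (- r)) \<in> borel_measurable lborel"
    by simp
  ultimately show ?thesis unfolding set_integrable_def by (simp add: integrable_completion)
qed

text \<open>One number d serves two ends: it keeps the whole ray away from 0, and it dominates |Im
  z|, which will give summability over k.\<close>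

lemma ray_distance:
  assumes "z \<notin> \<real>\<^sub>\<le>\<^sub>0"
  shows "\<exists>d>0. \<bar>Im z\<bar> \<le> d \<and> (\<forall>r\<ge>0. d \<le> norm (z + of_real r))"
proof (cases "Im z = 0")
  case True
  have "Re z \<le> norm (z + of_real r)" if "r \<ge> 0" for r
    using that complex_Re_le_cmod[of "z + of_real r"] by simp
  thus ?thesis using True assms by (intro exI[of _ "Re z"]) (auto simp: complex_nonpos_Reals_iff)
next
  case False
  have "\<bar>Im z\<bar> \<le> norm (z + of_real r)" for r using abs_Im_le_cmod[of "z + of_real r"] by simp
  thus ?thesis using False by (intro exI[of _ "\<bar>Im z\<bar>"]) auto
qed

lemma z_shift_ray_distance:
  assumes adm: "\<And>k. z_shift W k \<notin> \<real>\<^sub>\<le>\<^sub>0"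
  obtains d :: "int \<Rightarrow> real" where "\<And>k. d k > 0" "\<And>k r. r \<ge> 0 \<Longrightarrow> d k \<le> norm (z_shift W k + of_real r)"
    "(\<lambda>k. 1 / (d k)\<^sup>2) summable_on UNIV"
proof -
  have "\<forall>k. \<exists>d>0. \<bar>Im (z_shift W k)\<bar> \<le> d \<and> (\<forall>r\<ge>0. d \<le> norm (z_shift W k + of_real r))"
    using adm ray_distance by blast
  then obtain d :: "int \<Rightarrow> real" where pos: "\<And>k. d k > 0" and im: "\<And>k. \<bar>Im (z_shift W k)\<bar> \<le> d k"
    and bound: "\<And>k r. r \<ge> 0 \<Longrightarrow> d k \<le> norm (z_shift W k + of_real r)"
    by metis
  have ge: "d k \<ge> \<bar>Im W - 2 * pi * k\<bar>" for k
    using im[of k] by (simp add: z_shift_def)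
  \<comment> \<open>For |k| > N, |Im W - 2 pi k| >= 2|k| - |Im W| > |k|; the remaining k are finite
    in number and only need d k > 0.\<close>
  define N where "N = \<lceil>\<bar>Im W\<bar>\<rceil>"
  have "(\<lambda>k. 1 / (d k)\<^sup>2) summable_on (UNIV - {-N..N})"
  proof (rule summable_on_comparison_test)
    show "(\<lambda>k. 1 / (real_of_int k)\<^sup>2) summable_on (UNIV - {-N..N})"
      using summable_on_int_inverse_squares by (rule summable_on_subset) auto
    fix k assume k: "k \<in> UNIV - {-N..N}"
    hence "\<bar>k\<bar> > N" by auto
    hence "\<bar>Im W\<bar> < \<bar>real_of_int k\<bar>" and k0: "k \<noteq> 0" unfolding N_def by linarith+
    moreover have "\<bar>2 * pi * k\<bar> \<ge> 2 * \<bar>real_of_int k\<bar>"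
      using pi_ge_two by (simp add: abs_mult mult_right_mono)
    ultimately have "\<bar>real_of_int k\<bar> \<le> d k" using ge[of k] by linarith
    hence "(real_of_int k)\<^sup>2 \<le> (d k)\<^sup>2" using power_mono[of "\<bar>real_of_int k\<bar>" "d k" 2] by simp
    thus "1 / (d k)\<^sup>2 \<le> 1 / (real_of_int k)\<^sup>2" using k0 pos[of k] by (intro divide_left_mono) auto
  qed auto
  moreover have "(\<lambda>k. 1 / (d k)\<^sup>2) summable_on {-N..N}" by simp
  ultimately have "(\<lambda>k. 1 / (d k)\<^sup>2) summable_on ((UNIV - {-N..N}) \<union> {-N..N})" by (rule summable_on_union)
  moreover have "(UNIV - {-N..N}) \<union> {-N..N} = UNIV" by auto
  ultimately show ?thesis using that pos bound by metis
qed

text \<open>The value 1 would put a point of the ray at some 2 pi i k, so the k-th shift of W would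
  be -r.\<close>

lemma exp_ray_neq_1:
  assumes "\<And>k. z_shift W k \<notin> \<real>\<^sub>\<le>\<^sub>0" "r \<ge> 0"
  shows "exp (W + of_real r) \<noteq> 1"
proof
  assume "exp (W + of_real r) = 1"
  then obtain k :: int where "Re (W + of_real r) = 0" "Im (W + of_real r) = of_int (2 * k) * pi"
    by (auto simp: exp_eq_1)
  hence "z_shift W k = - of_real r" by (simp add: z_shift_def complex_eq_iff)
  thus False using assms(1)[of k] assms(2) by (simp add: complex_nonpos_Reals_iff)
qed

context bump
begin

text \<open>This is U(z X) with the integrals over x and along the ray interchanged, written as a
  Lebesgue integral for the convergence theorems.\<close>

definition V :: "complex \<Rightarrow> complex" where
  "V z = (LINT r:{0..}|lborel. M (z + of_real r) / (z + of_real r))"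

text \<open>The terms are bounded by C * exp (-r) / (d k)^2, integrable in r and summable in k. This
  gives absolute summability of the integrals and, by dominated convergence, passes the pointwise
  limit of symmetric partial sums under the integral.\<close>

lemma
  assumes adm: "\<And>k. z_shift W k \<notin> \<real>\<^sub>\<le>\<^sub>0"
  defines "F \<equiv> \<lambda>w. exp (- of_nat X * w) / (exp w - 1)"
  shows V_z_shift_summable: "(\<lambda>k. V (z_shift W k)) summable_on UNIV"
    and infsum_V_z_shift: "(\<Sum>\<^sub>\<infinity>k. V (z_shift W k)) = (LINT r:{0..}|lborel. F (W + of_real r))"
    and set_integrable_infsum_V: "set_integrable lborel {0..} (\<lambda>r. F (W + of_real r))"
proof -
  obtain d where d: "\<And>k. d k > 0" "\<And>k r. r \<ge> 0 \<Longrightarrow> d k \<le> norm (z_shift W k + of_real r)"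
    "(\<lambda>k. 1 / (d k)\<^sup>2) summable_on UNIV"
    using z_shift_ray_distance[OF adm] by blast
  define C where "C = b'_max * exp (\<bar>Re W\<bar> * (real X + 1))"
  have C: "C \<ge> 0" using b'_max_nonneg by (simp add: C_def)
  define g where "g = (\<lambda>k r. M (z_shift W k + of_real r) / (z_shift W k + of_real r))"
  have nz: "z_shift W k + of_real r \<noteq> 0" if "r \<ge> 0" for k r using d(1)[of k] d(2)[OF that, of k] by auto
  have g_le: "norm (g k r) \<le> C * exp (- r) * (1 / (d k)\<^sup>2)" if r: "r \<ge> 0" for k r
  proof -
    let ?z = "z_shift W k + of_real r"
    \<comment> \<open>Writing M(z)/z as z M(z) / z^2 brings in the bound from integration by
      parts.\<close>
    have "norm (?z * M ?z) \<le> C * exp (- r)"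
      unfolding C_def by (rule norm_mult_M_le) (use r in \<open>simp_all add: z_shift_def\<close>)
    moreover have "(d k)\<^sup>2 \<le> (norm ?z)\<^sup>2" using d(1)[of k] d(2)[OF r, of k] by (intro power_mono) auto
    ultimately have "norm (?z * M ?z) / (norm ?z)\<^sup>2 \<le> (C * exp (- r)) / (d k)\<^sup>2"
      using d(1)[of k] C by (intro frac_le) auto
    moreover have "norm (?z * M ?z) / (norm ?z)\<^sup>2 = norm (g k r)"
      using nz[OF r, of k] by (simp add: g_def norm_mult norm_divide power2_eq_square)
    ultimately show ?thesis by simp
  qed
  define G where "G = (\<lambda>k r. indicat_real {0..} r *\<^sub>R g k r)"
  have V_eq: "V (z_shift W k) = integral\<^sup>L lborel (G k)" for k
    by (simp add: V_def set_lebesgue_integral_def G_def g_def)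
  have G_meas: "G k \<in> borel_measurable lborel" for k
    unfolding G_def g_def using nz
    by (simp, intro borel_measurable_continuous_on_indicator continuous_intros continuous_on_compose2[OF continuous_on_M[of UNIV]]) auto
  let ?e = "\<lambda>r::real. indicat_real {0..} r *\<^sub>R exp (- r)"
  have e_int: "integrable lborel ?e" using set_integrable_exp_neg by (simp add: set_integrable_def)
  have e_nonneg: "?e r \<ge> 0" for r by (simp add: indicator_def)
  have G_le: "norm (G k r) \<le> (C * ?e r) * (1 / (d k)\<^sup>2)" for k r
    using g_le[of r k] by (simp add: G_def indicator_def)
  have G_int: "integrable lborel (G k)" for k
    by (rule Bochner_Integration.integrable_bound[of _ "\<lambda>r. (C * ?e r) * (1 / (d k)\<^sup>2)"])
       (use e_int G_meas G_le[of k] C e_nonneg in \<open>auto intro!: AE_I2 intro: order_trans[OF _ abs_ge_self]\<close>)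
  define I where "I = integral\<^sup>L lborel ?e"
  have V_le: "norm (V (z_shift W k)) \<le> (C * I) * (1 / (d k)\<^sup>2)" for k
  proof -
    have "norm (V (z_shift W k)) \<le> (LINT r|lborel. norm (G k r))"
      unfolding V_eq by (rule integral_norm_bound)
    also have "\<dots> \<le> (LINT r|lborel. (C * ?e r) * (1 / (d k)\<^sup>2))"
      by (intro integral_mono integrable_norm G_int integrable_mult_left integrable_mult_right e_int G_le)
    also have "\<dots> = (C * I) * (1 / (d k)\<^sup>2)" unfolding I_def
      by (simp only: integral_mult_left_zero integral_mult_right_zero)
    finally show ?thesis .
  qed
  have "(\<lambda>k. (C * I) * (1 / (d k)\<^sup>2)) summable_on UNIV" using d(3) by (rule summable_on_cmult_right)
  hence "(\<lambda>k. norm (V (z_shift W k))) summable_on UNIV"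
    using V_le by (rule Infinite_Sum.abs_summable_on_comparison_test')
  thus summ: "(\<lambda>k. V (z_shift W k)) summable_on UNIV" by (rule abs_summable_summable)
  define S where "S = (\<lambda>N::nat. \<lambda>r. \<Sum>k = -int N..int N. G k r)"
  define Fi where "Fi = (\<lambda>r. indicat_real {0..} r *\<^sub>R F (W + of_real r))"
  define D where "D = (\<Sum>\<^sub>\<infinity>k. 1 / (d k)\<^sup>2)"
  have S_lim: "(\<lambda>N. S N r) \<longlonglongrightarrow> Fi r" for r
  proof (cases "r \<ge> 0")
    case True
    have "z_shift (W + of_real r) k = z_shift W k + of_real r" for k by (simp add: z_shift_def)
    hence "G k r = M (z_shift (W + of_real r) k) / z_shift (W + of_real r) k" for k
      using True by (simp add: G_def g_def)
    moreover have "Fi r = F (W + of_real r)" using True by (simp add: Fi_def)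
    ultimately show ?thesis
      using sum_M_z_shift[OF exp_ray_neq_1[OF adm True]] by (simp only: S_def F_def)
  qed (simp add: S_def Fi_def G_def)
  have S_le: "norm (S N r) \<le> (C * ?e r) * D" for N r
  proof -
    have "norm (S N r) \<le> (\<Sum>k = -int N..int N. (C * ?e r) * (1 / (d k)\<^sup>2))"
      unfolding S_def by (intro sum_norm_le G_le)
    also have "\<dots> = (C * ?e r) * (\<Sum>k = -int N..int N. 1 / (d k)\<^sup>2)" by (rule sum_distrib_left[symmetric])
    also have "\<dots> \<le> (C * ?e r) * D" unfolding D_def
      using C e_nonneg[of r] by (intro mult_left_mono finite_sum_le_infsum d(3)) auto
    finally show ?thesis .
  qed
  have S_meas: "S N \<in> borel_measurable lborel" for N
    unfolding S_def by (intro borel_measurable_sum G_meas)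
  have Fi_meas: "Fi \<in> borel_measurable lborel"
    by (rule borel_measurable_LIMSEQ_metric[OF S_meas S_lim])
  have w_int: "integrable lborel (\<lambda>r. (C * ?e r) * D)"
    by (intro integrable_mult_left integrable_mult_right e_int)
  note dct = Fi_meas S_meas w_int AE_I2[OF S_lim] AE_I2[OF S_le]
  have dom: "integrable lborel Fi" "(\<lambda>N. integral\<^sup>L lborel (S N)) \<longlonglongrightarrow> integral\<^sup>L lborel Fi"
    by (rule integrable_dominated_convergence[OF dct], rule integral_dominated_convergence[OF dct])
  show "set_integrable lborel {0..} (\<lambda>r. F (W + of_real r))"
    using dom(1) by (simp add: set_integrable_def Fi_def)
  have "integral\<^sup>L lborel (S N) = (\<Sum>k = -int N..int N. V (z_shift W k))" for N
    unfolding S_def V_eq by (intro Bochner_Integration.integral_sum G_int)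
  hence "(\<lambda>N. \<Sum>k = -int N..int N. V (z_shift W k)) \<longlonglongrightarrow> integral\<^sup>L lborel Fi" using dom(2) by simp
  \<comment> \<open>Absolute summability identifies the limit of symmetric sums with the unordered
    sum.\<close>
  moreover have "(\<lambda>N. \<Sum>k = -int N..int N. V (z_shift W k)) \<longlonglongrightarrow> (\<Sum>\<^sub>\<infinity>k. V (z_shift W k))"
    by (intro has_sum_int_imp_tendsto has_sum_infsum summ)
  ultimately have "(\<Sum>\<^sub>\<infinity>k. V (z_shift W k)) = integral\<^sup>L lborel Fi" by (rule LIMSEQ_unique[rotated])
  thus "(\<Sum>\<^sub>\<infinity>k. V (z_shift W k)) = (LINT r:{0..}|lborel. F (W + of_real r))"
    by (simp add: set_lebesgue_integral_def Fi_def)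
qed

end

text \<open>With y = exp (-w), the logarithmic derivative is y / (1 - y) minus the first X powers of
  y, that is the geometric tail y^(X+1) / (1 - y) = exp (-Xw) / (exp w - 1). The form H' = F * H
  needs no logarithm.\<close>

lemma partial_log_product_deriv:
  fixes w :: complex
  assumes "exp w \<noteq> 1"
  shows "((\<lambda>w. (1 - exp (- w)) * exp (\<Sum>n=1..X. exp (- w) ^ n / of_nat n)) has_field_derivative
          exp (- of_nat X * w) / (exp w - 1) * ((1 - exp (- w)) * exp (\<Sum>n=1..X. exp (- w) ^ n / of_nat n))) (at w)"
proof -
  let ?y = "exp (- w)"
  define S where "S = (\<lambda>w::complex. \<Sum>n=1..X. exp (- w) ^ n / of_nat n)"
  have S: "(S has_field_derivative (\<Sum>n=1..X. - (?y ^ n))) (at w)"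
  proof -
    have "((\<lambda>w. exp (- w) ^ n / of_nat n) has_field_derivative - (?y ^ n)) (at w)" if "n \<in> {1..X}" for n
    proof -
      have "?y * ?y ^ (n - Suc 0) = ?y ^ n" using that by (simp add: power_eq_if)
      thus ?thesis using that by (auto intro!: derivative_eq_intros simp: mult.commute)
    qed
    thus ?thesis unfolding S_def by (rule DERIV_sum)
  qed
  have geo: "(1 - ?y) * (\<Sum>n=1..X. ?y ^ n) = ?y - ?y ^ Suc X"
  proof (induction X)
    case (Suc X)
    have "(1 - ?y) * (\<Sum>n=1..Suc X. ?y ^ n) = (1 - ?y) * (\<Sum>n=1..X. ?y ^ n) + (1 - ?y) * ?y ^ Suc X"
      by (simp add: distrib_left)
    also have "\<dots> = ?y - ?y ^ Suc (Suc X)" unfolding Suc.IH by (simp add: algebra_simps)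
    finally show ?case .
  qed simp
  have y: "?y * exp w = 1" by (simp add: exp_minus)
  hence "(1 - ?y) = ?y * (exp w - 1)" by (simp add: algebra_simps)
  hence "exp (- of_nat X * w) / (exp w - 1) * (1 - ?y) = ?y ^ Suc X"
    using assms by (simp add: exp_of_nat_mult[symmetric])
  also have "\<dots> = ?y + (1 - ?y) * (\<Sum>n=1..X. - (?y ^ n))" using geo by (simp add: sum_negf)
  finally have "exp (- of_nat X * w) / (exp w - 1) * ((1 - ?y) * exp (S w)) =
      (?y + (1 - ?y) * (\<Sum>n=1..X. - (?y ^ n))) * exp (S w)" by (simp only: mult.assoc[symmetric])
  moreover have "((\<lambda>w. (1 - exp (- w)) * exp (S w)) has_field_derivative
      (?y + (1 - ?y) * (\<Sum>n=1..X. - (?y ^ n))) * exp (S w)) (at w)"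
    by (auto intro!: derivative_eq_intros S simp: algebra_simps)
  ultimately show ?thesis by (simp only: S_def)
qed

context bump
begin

text \<open>Since H' = F * H, the product \<open>exp (- I R) * H (W + of_real R)\<close> is constant
  in R. It equals H W at R = 0, and its limit at infinity is the left hand side because H tends to
  1.\<close>

lemma exp_neg_infsum_V:
  assumes adm: "\<And>k. z_shift W k \<notin> \<real>\<^sub>\<le>\<^sub>0"
  shows "exp (- (\<Sum>\<^sub>\<infinity>k. V (z_shift W k))) = (1 - exp (- W)) * exp (\<Sum>n=1..X. exp (- W) ^ n / of_nat n)"
proof -
  define F where "F = (\<lambda>w::complex. exp (- of_nat X * w) / (exp w - 1))"
  define H where "H = (\<lambda>w::complex. (1 - exp (- w)) * exp (\<Sum>n=1..X. exp (- w) ^ n / of_nat n))"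
  define f where "f = (\<lambda>r::real. F (W + of_real r))"
  define I where "I = (\<lambda>R. integral {0..R} f)"
  have f_int: "set_integrable lborel {0..} f"
    unfolding f_def F_def by (rule set_integrable_infsum_V[OF adm])
  have nz: "exp (W + of_real r) - 1 \<noteq> 0" if "r \<ge> 0" for r using exp_ray_neq_1[OF adm that] by simp
  have f_cont: "continuous_on {0..} f"
    unfolding f_def F_def using nz by (intro continuous_intros) auto
  have const: "exp (- I R) * H (W + of_real R) = H W" if R: "R \<ge> 0" for R
  proof -
    have "((\<lambda>r. exp (- I r) * H (W + of_real r)) has_vector_derivative 0) (at r within {0..R})" if r: "r \<in> {0..R}" for r
    proof -
      have "(I has_vector_derivative f r) (at r within {0..R})" unfolding I_def
        by (intro integral_has_vector_derivative continuous_on_subset[OF f_cont] r) auto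
      hence "((\<lambda>r. - I r) has_vector_derivative - f r) (at r within {0..R})"
        by (rule has_vector_derivative_minus)
      from field_vector_diff_chain_within[OF this, of exp "exp (- I r)"]
      have 1: "((\<lambda>r. exp (- I r)) has_vector_derivative - f r * exp (- I r)) (at r within {0..R})"
        by (simp add: o_def DERIV_exp has_field_derivative_at_within)
      have "(H has_field_derivative F (W + of_real r) * H (W + of_real r)) (at (W + of_real r))"
        unfolding H_def F_def by (rule partial_log_product_deriv) (use nz[of r] r in simp)
      hence "((\<lambda>x. H (W + x)) has_field_derivative f r * H (W + of_real r)) (at (of_real r))"
        unfolding f_def using DERIV_shift[of H _ "of_real r" W] by (simp add: add.commute)
      from has_vector_derivative_real_field[OF this]
      have 2: "((\<lambda>r. H (W + of_real r)) has_vector_derivative f r * H (W + of_real r)) (at r within {0..R})" .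
      from has_vector_derivative_mult[OF 1 2] show ?thesis by (simp add: algebra_simps)
    qed
    from has_vector_derivative_zero_constant[OF _ this]
    obtain c where "\<And>r. r \<in> {0..R} \<Longrightarrow> exp (- I r) * H (W + of_real r) = c" by auto
    from this[of 0] this[of R] R show ?thesis by (simp add: I_def)
  qed
  have I_lim: "(I \<longlongrightarrow> (LINT r:{0..}|lborel. f r)) at_top"
  proof -
    have "(LINT r:{0..R}|lborel. f r) = I R" for R
      unfolding I_def by (intro set_borel_integral_eq_integral(2) borel_integrable_atLeastAtMost' continuous_on_subset[OF f_cont]) auto
    with tendsto_set_lebesgue_integral_at_top[OF _ f_int] show ?thesis by simp
  qed
  have "((\<lambda>R::real. exp (- W) * of_real (exp (- R))) \<longlongrightarrow> exp (- W) * of_real 0) at_top"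
    by (intro tendsto_intros filterlim_compose[OF exp_at_bot] filterlim_uminus_at_bot_at_top)
  hence "((\<lambda>R::real. exp (- (W + of_real R))) \<longlongrightarrow> 0) at_top"
    by (simp only: minus_add_distrib exp_add of_real_minus[symmetric] exp_of_real mult_zero_right of_real_0)
  hence "((\<lambda>R::real. H (W + of_real R)) \<longlongrightarrow> (1 - 0) * exp (\<Sum>n=1..X. 0 ^ n / of_nat n)) at_top"
    unfolding H_def by (intro tendsto_intros) auto
  also have "(\<Sum>n=1..X. (0::complex) ^ n / of_nat n) = 0" by (intro sum.neutral) (auto simp: power_0_left)
  finally have "((\<lambda>R. exp (- I R) * H (W + of_real R)) \<longlongrightarrow> exp (- (LINT r:{0..}|lborel. f r)) * ((1 - 0) * exp 0)) at_top"
    using I_lim by (intro tendsto_intros)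
  moreover have "eventually (\<lambda>R. exp (- I R) * H (W + of_real R) = H W) at_top"
    using eventually_ge_at_top[of 0] by eventually_elim (rule const)
  hence "((\<lambda>R. exp (- I R) * H (W + of_real R)) \<longlongrightarrow> H W) at_top" by (rule tendsto_eventually)
  ultimately have "exp (- (LINT r:{0..}|lborel. f r)) * ((1 - 0) * exp 0) = H W"
    by (intro tendsto_unique[OF _ _ _]) auto
  moreover have "(\<Sum>\<^sub>\<infinity>k. V (z_shift W k)) = (LINT r:{0..}|lborel. f r)"
    unfolding f_def F_def by (rule infsum_V_z_shift[OF adm])
  ultimately show ?thesis by (simp add: H_def)
qed

end

section \<open>The function U\<close>

lemma set_integrable_E1:
  fixes y :: complex
  assumes "y \<notin> \<real>\<^sub>\<le>\<^sub>0"
  shows "set_integrable lborel {0..} (\<lambda>t::real. exp (- (y + of_real t)) / (y + of_real t))"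
proof -
  obtain d where d: "d > 0" "\<And>r. r \<ge> 0 \<Longrightarrow> d \<le> norm (y + of_real r)"
    using ray_distance[OF assms] by blast
  have nz: "y + of_real t \<noteq> 0" if "t \<ge> 0" for t using d(1) d(2)[OF that] by auto
  have "integrable lborel (\<lambda>t. exp (- Re y) / d * (indicat_real {0..} t *\<^sub>R exp (- t)))"
    using set_integrable_exp_neg unfolding set_integrable_def by (rule integrable_mult_right)
  thus ?thesis unfolding set_integrable_def
  proof (rule Bochner_Integration.integrable_bound)
    show "(\<lambda>t. indicat_real {0..} t *\<^sub>R (exp (- (y + of_real t)) / (y + of_real t))) \<in> borel_measurable lborel"
    proof -
      have "continuous_on {0..} (\<lambda>t::real. exp (- (y + of_real t)) / (y + of_real t))"
        using nz by (intro continuous_intros) auto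
      thus ?thesis using borel_measurable_continuous_on_indicator[of "{0..}"] by simp
    qed
    have "norm (exp (- (y + of_real t)) / (y + of_real t)) \<le> exp (- Re y) / d * exp (- t)" if t: "t \<ge> 0" for t
    proof -
      have "norm (exp (- (y + of_real t)) / (y + of_real t)) = exp (- Re y) * exp (- t) / norm (y + of_real t)"
        by (simp add: norm_divide norm_exp_eq_Re exp_add[symmetric])
      also have "\<dots> \<le> exp (- Re y) * exp (- t) / d" using d(1) d(2)[OF t] by (intro frac_le) auto
      finally show ?thesis by simp
    qed
    thus "AE t in lborel. norm (indicat_real {0..} t *\<^sub>R (exp (- (y + of_real t)) / (y + of_real t)))
        \<le> norm (exp (- Re y) / d * (indicat_real {0..} t *\<^sub>R exp (- t)))"
      using d(1) by (intro AE_I2) (auto simp: indicator_def)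
  qed
qed

text \<open>The substitution t = c * r removes c from the denominator, so that ln x will occur only
  in the exponent and the integral over x becomes a Laplace transform.\<close>

lemma E1_scaled:
  assumes "z \<notin> \<real>\<^sub>\<le>\<^sub>0" "c > 0"
  shows "E1 (z * of_real c) = (LINT r:{0..}|lborel. exp (- of_real c * (z + of_real r)) / (z + of_real r))"
proof -
  let ?f = "\<lambda>t::real. exp (- (z * of_real c + of_real t)) / (z * of_real c + of_real t)"
  have "z * of_real c \<notin> \<real>\<^sub>\<le>\<^sub>0"
    using assms by (auto simp: complex_nonpos_Reals_iff mult_le_0_iff)
  hence "E1 (z * of_real c) = (LINT t:{0..}|lborel. ?f t)"
    unfolding E1_def by (intro set_borel_integral_eq_integral(2)[symmetric] set_integrable_E1)
  also have "\<dots> = c *\<^sub>R (LINT r|lborel. indicat_real {0..} (0 + c * r) *\<^sub>R ?f (0 + c * r))"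
    unfolding set_lebesgue_integral_def using lborel_integral_real_affine[of c "\<lambda>t. indicat_real {0..} t *\<^sub>R ?f t" 0] assms(2) by simp
  also have "\<dots> = (LINT r|lborel. c *\<^sub>R (indicat_real {0..} (0 + c * r) *\<^sub>R ?f (0 + c * r)))"
    by (rule integral_scaleR_right[symmetric])
  also have "\<dots> = (LINT r:{0..}|lborel. exp (- of_real c * (z + of_real r)) / (z + of_real r))"
    unfolding set_lebesgue_integral_def
  proof (intro Bochner_Integration.integral_cong refl)
    fix r :: real
    have "indicat_real {0..} (0 + c * r) = indicat_real {0..} r"
      using assms(2) by (simp add: indicator_def zero_le_mult_iff)
    moreover have "z * of_real c + of_real (0 + c * r) = of_real c * (z + of_real r)"
      by (simp add: algebra_simps)
    ultimately show "c *\<^sub>R (indicat_real {0..} (0 + c * r) *\<^sub>R ?f (0 + c * r)) =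
         indicat_real {0..} r *\<^sub>R (exp (- of_real c * (z + of_real r)) / (z + of_real r))"
      using assms(2) by (simp add: scaleR_conv_of_real)
  qed
  finally show ?thesis .
qed

text \<open>The interval in \<open>u_support\<close> is the image of the open unit interval under x
  = exp (1 + t / X); being open, it forces \<open>u\<close> to vanish at both ends.\<close>

locale mollifier =
  fixes u u' :: "real \<Rightarrow> real" and X :: nat
  assumes u_deriv: "\<And>x. (u has_real_derivative u' x) (at x)"
    and u'_cont: "continuous_on UNIV u'"
    and u_support: "\<And>x. x \<notin> {exp 1<..<exp (1 + 1 / X)} \<Longrightarrow> u x = 0"
    and u_integral: "integral {0..} u = 1"
    and X_ge_1: "X \<ge> 1"
begin

text \<open>The substitution \<open>x = exp (1 + t / X)\<close> turns \<open>X * ln x\<close> into \<open>X + t\<close>.\<close>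
definition b :: "real \<Rightarrow> real" where
  "b t = u (exp (1 + t / X)) * exp (1 + t / X) / X"

definition b' :: "real \<Rightarrow> real" where
  "b' t = (u' (exp (1 + t / X)) * exp (1 + t / X) + u (exp (1 + t / X))) * exp (1 + t / X) / X\<^sup>2"

abbreviation J :: "real set" where "J \<equiv> {exp 1..exp (1 + 1 / X)}"

lemma u_cont: "continuous_on A u"
  using u_deriv by (meson DERIV_continuous_on has_field_derivative_at_within)

lemma J_substitution:
  fixes h :: "real \<Rightarrow> complex"
  assumes "continuous_on J h"
  shows "((\<lambda>t. of_real (exp (1 + t / X) / X) * h (exp (1 + t / X))) has_integral integral J h) {0..1}"
proof -
  have "((\<lambda>t. (exp (1 + t / X) / X) *\<^sub>R h (exp (1 + t / X))) has_integral
          integral {exp (1 + 0 / X)..exp (1 + 1 / X)} h) {0..1}"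
    using X_ge_1
    by (intro has_integral_substitution[where c = "exp 1" and d = "exp (1 + 1 / X)"] assms)
       (auto intro!: derivative_eq_intros simp: divide_right_mono)
  thus ?thesis by (simp add: scaleR_conv_of_real)
qed

lemma integral_u_J: "integral J u = 1"
proof -
  have "0 < exp (1 :: real)" by simp
  hence "(\<lambda>x. if x \<in> {0..} then u x else 0) = (\<lambda>x. if x \<in> J then u x else 0)"
  proof (intro ext)
    fix x
    show "(if x \<in> {0..} then u x else 0) = (if x \<in> J then u x else 0)"
    proof (cases "x \<in> J")
      case True
      hence "exp 1 \<le> x" by simp
      with \<open>0 < exp 1\<close> have "x \<ge> 0" by linarith
      with True show ?thesis by simp
    next
      case False
      hence "u x = 0" by (intro u_support) auto
      thus ?thesis by simp
    qed
  qed
  hence "integral UNIV (\<lambda>x. if x \<in> {0..} then u x else 0) = integral UNIV (\<lambda>x. if x \<in> J then u x else 0)"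
    by (rule arg_cong)
  hence "integral {0..} u = integral J u" by (simp only: integral_restrict_UNIV)
  thus ?thesis using u_integral by simp
qed

sublocale bump b b' X
proof
  fix t :: real
  show "(b has_real_derivative b' t) (at t)"
  proof -
    have e: "((\<lambda>t. exp (1 + t / X)) has_real_derivative exp (1 + t / X) / X) (at t)"
      using X_ge_1 by (auto intro!: derivative_eq_intros)
    from DERIV_chain2[OF u_deriv e]
    have "((\<lambda>t. u (exp (1 + t / X))) has_real_derivative u' (exp (1 + t / X)) * (exp (1 + t / X) / X)) (at t)" .
    from DERIV_cdivide[OF DERIV_mult[OF this e], of X]
    show ?thesis unfolding b_def[abs_def] b'_def using X_ge_1
      by (elim DERIV_cong) (simp add: field_simps power2_eq_square)
  qed
next
  show "continuous_on UNIV b'" unfolding b'_def[abs_def] using X_ge_1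
    by (intro continuous_intros continuous_on_compose2[OF u'_cont] continuous_on_compose2[OF u_cont[of UNIV]]) auto
  show "b 0 = 0" "b 1 = 0" using u_support by (auto simp: b_def)
  \<comment> \<open>\<open>J_substitution\<close> is stated for complex functions, so the real mass
    is computed in the complex numbers and its real part taken.\<close>
  show "integral {0..1} b = 1"
  proof -
    have "((\<lambda>t. of_real (exp (1 + t / X) / X) * of_real (u (exp (1 + t / X)))) has_integral integral J (\<lambda>x. of_real (u x) :: complex)) {0..1}"
      by (intro J_substitution continuous_intros u_cont)
    moreover have "(u has_integral integral J u) J"
      by (intro integrable_integral integrable_continuous_real u_cont)
    from has_integral_linear[OF this bounded_linear_of_real[where 'a = complex]]
    have "integral J (\<lambda>x. of_real (u x) :: complex) = of_real (integral J u)"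
      by (simp add: o_def integral_unique)
    ultimately have "((\<lambda>t. of_real (b t) :: complex) has_integral 1) {0..1}"
      by (simp add: integral_u_J b_def mult_ac)
    from has_integral_Re[OF this] show ?thesis by (simp add: integral_unique)
  qed
  show "X \<ge> 1" by (rule X_ge_1)
qed

lemma M_eq_integral_J: "M z = integral J (\<lambda>x. of_real (u x) * exp (- of_real (X * ln x) * z))"
proof -
  have pos: "x > 0" if "x \<in> J" for x using that by (meson atLeastAtMost_iff exp_gt_zero less_le_trans)
  have "((\<lambda>t. of_real (exp (1 + t / X) / X) * (of_real (u (exp (1 + t / X))) * exp (- of_real (X * ln (exp (1 + t / X))) * z)))
      has_integral integral J (\<lambda>x. of_real (u x) * exp (- of_real (X * ln x) * z))) {0..1}"
    by (intro J_substitution continuous_intros u_cont) (use pos in force)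
  moreover have "of_real (exp (1 + t / X) / X) * (of_real (u (exp (1 + t / X))) * exp (- of_real (X * ln (exp (1 + t / X))) * z)) =
      of_real (b t) * exp (- z * of_real (real X + t))" for t
  proof -
    have eq: "real X * ln (exp (1 + t / X)) = real X + t" using X_ge_1 by (simp add: field_simps)
    show ?thesis unfolding eq b_def by (simp add: algebra_simps)
  qed
  ultimately show ?thesis unfolding M_def by (simp add: integral_unique)
qed

text \<open>Fubini for a kernel on \<open>J\<close> times the half line: integrating over r first
  gives E1 by \<open>E1_scaled\<close>, over x first gives M. The majorant C * exp (-r) uses X * ln
  x >= 1 and the distance d of the ray from 0.\<close>

lemma Ufun_eq_V:
  assumes z: "z \<notin> \<real>\<^sub>\<le>\<^sub>0"
  shows "Ufun u (z * of_nat X) = V z"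
proof -
  obtain d where d: "d > 0" "\<And>r. r \<ge> 0 \<Longrightarrow> d \<le> norm (z + of_real r)"
    using ray_distance[OF z] by blast
  have nz: "z + of_real r \<noteq> 0" if "r \<ge> 0" for r using d(1) d(2)[OF that] by auto
  have pos: "x > 0" if "x \<in> J" for x using that by (meson atLeastAtMost_iff exp_gt_zero less_le_trans)
  have ln_bounds: "1 \<le> ln x" "ln x \<le> 1 + 1 / X" if "x \<in> J" for x
  proof -
    show "1 \<le> ln x" using that pos[OF that] by (simp add: ln_ge_iff)
    have "ln x \<le> ln (exp (1 + 1 / X))" using that pos[OF that] by (subst ln_le_cancel_iff) auto
    thus "ln x \<le> 1 + 1 / X" by simp
  qed
  define k where "k = (\<lambda>x r. of_real (u x) * (exp (- of_real (X * ln x) * (z + of_real r)) / (z + of_real r)))"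
  define \<Phi> where "\<Phi> = (\<lambda>x r. indicat_real J x *\<^sub>R (indicat_real {0..} r *\<^sub>R k x r))"
  define U where "U = (SUP x\<in>J. \<bar>u x\<bar>)"
  have U: "\<bar>u x\<bar> \<le> U" if "x \<in> J" for x
    unfolding U_def using that
    by (intro cSUP_upper bounded_imp_bdd_above compact_imp_bounded compact_continuous_image
        continuous_intros u_cont) auto
  define C where "C = U * (exp (\<bar>Re z\<bar> * (X + 1)) / d)"
  have k_le: "norm (k x r) \<le> C * exp (- r)" if x: "x \<in> J" and r: "r \<ge> 0" for x r
  proof -
    let ?s = "X * ln x"
    have s: "?s \<ge> 1" "?s \<le> X + 1"
    proof -
      have "1 * 1 \<le> ?s" using X_ge_1 ln_bounds[OF x] by (intro mult_mono) auto
      thus "?s \<ge> 1" by simp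
      have "?s \<le> X * (1 + 1 / X)" using ln_bounds[OF x] by (intro mult_left_mono) auto
      also have "X * (1 + 1 / X) = X + 1" using X_ge_1 by (simp add: field_simps)
      finally show "?s \<le> X + 1" .
    qed
    have "- Re z * ?s \<le> \<bar>Re z\<bar> * (X + 1)" using s by (intro mult_mono) auto
    moreover have "r * 1 \<le> r * ?s" using r s by (intro mult_left_mono) auto
    ultimately have le: "- ?s * (Re z + r) \<le> \<bar>Re z\<bar> * (X + 1) - r" by (simp add: algebra_simps)
    have "norm (exp (- of_real ?s * (z + of_real r))) = exp (- ?s * (Re z + r))"
      by (simp add: norm_exp_eq_Re)
    also have "\<dots> \<le> exp (\<bar>Re z\<bar> * (X + 1)) * exp (- r)" using le by (simp add: exp_add[symmetric])
    finally have "norm (exp (- of_real ?s * (z + of_real r)) / (z + of_real r)) \<le> exp (\<bar>Re z\<bar> * (X + 1)) * exp (- r) / d"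
      unfolding norm_divide using d(1) d(2)[OF r] by (intro frac_le) auto
    hence "norm (k x r) \<le> U * (exp (\<bar>Re z\<bar> * (X + 1)) * exp (- r) / d)"
      unfolding k_def norm_mult using U[OF x] by (intro mult_mono) auto
    thus ?thesis by (simp add: C_def)
  qed
  have \<Phi>_le: "norm (\<Phi> x r) \<le> C * (indicat_real J x * (indicat_real {0..} r *\<^sub>R exp (- r)))" for x r
    using k_le[of x r] by (simp add: \<Phi>_def indicator_def)
  have w_int: "integrable (lborel \<Otimes>\<^sub>M lborel) (\<lambda>(x, r). indicat_real J x * (indicat_real {0..} r *\<^sub>R exp (- r)))"
  proof (rule lborel_pair.Fubini_integrable)
    have eq: "(\<lambda>x. LINT r|lborel. norm (case (x, r) of (x, r) \<Rightarrow> indicat_real J x * (indicat_real {0..} r *\<^sub>R exp (- r)))) =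
          (\<lambda>x. indicat_real J x * (LINT r|lborel. indicat_real {0..} r *\<^sub>R exp (- r)))"
      by (simp add: abs_mult fun_eq_iff)
    show "integrable lborel (\<lambda>x. LINT r|lborel. norm (case (x, r) of (x, r) \<Rightarrow> indicat_real J x * (indicat_real {0..} r *\<^sub>R exp (- r))))"
      unfolding eq by (intro integrable_mult_left) simp
    show "AE x in lborel. integrable lborel (\<lambda>r. case (x, r) of (x, r) \<Rightarrow> indicat_real J x * (indicat_real {0..} r *\<^sub>R exp (- r)))"
      using set_integrable_exp_neg by (auto simp: set_integrable_def intro!: AE_I2)
  qed (auto simp: case_prod_unfold)
  have \<Phi>_int: "integrable (lborel \<Otimes>\<^sub>M lborel) (\<lambda>(x, r). \<Phi> x r)"
  proof (rule Bochner_Integration.integrable_bound[OF integrable_mult_right[OF w_int, of C]])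
    have "(\<lambda>p. indicat_real (J \<times> {0..}) p *\<^sub>R k (fst p) (snd p)) \<in> borel_measurable borel"
      unfolding k_def using pos nz
      by (intro borel_measurable_continuous_on_indicator continuous_intros continuous_on_compose2[OF u_cont[of UNIV]])
         (auto intro!: borel_closed closed_Times)
    moreover have "(\<lambda>p. indicat_real (J \<times> {0..}) p *\<^sub>R k (fst p) (snd p)) = (\<lambda>(x, r). \<Phi> x r)"
      by (auto simp: \<Phi>_def fun_eq_iff indicator_def)
    ultimately show "(\<lambda>(x, r). \<Phi> x r) \<in> borel_measurable (lborel \<Otimes>\<^sub>M lborel)"
      by (simp add: lborel_prod)
    show "AE p in lborel \<Otimes>\<^sub>M lborel. norm (case p of (x, r) \<Rightarrow> \<Phi> x r) \<le>
        norm (C * (case p of (x, r) \<Rightarrow> indicat_real J x * (indicat_real {0..} r *\<^sub>R exp (- r))))"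
      using \<Phi>_le by (intro AE_I2) (auto intro: order_trans[OF _ abs_ge_self])
  qed
  \<comment> \<open>The indicator of \<open>J\<close> may be widened to the half line of
    \<open>Ufun\<close>, since \<open>u\<close> vanishes outside \<open>J\<close>.\<close>
  have inner_r: "(LINT r|lborel. \<Phi> x r) = indicat_real {0..} x *\<^sub>R (of_real (u x) * E1 (z * of_nat X * of_real (ln x)))" for x
  proof (cases "x \<in> J")
    case True
    have "X * ln x > 0" using ln_bounds[OF True] X_ge_1 by simp
    from E1_scaled[OF z this]
    have E1: "(LINT r:{0..}|lborel. exp (- of_real (X * ln x) * (z + of_real r)) / (z + of_real r)) = E1 (z * of_nat X * of_real (ln x))"
      by (simp add: mult.assoc)
    have "(LINT r|lborel. \<Phi> x r) = (LINT r:{0..}|lborel. of_real (u x) *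
        (exp (- of_real (X * ln x) * (z + of_real r)) / (z + of_real r)))"
      using True by (simp add: \<Phi>_def k_def set_lebesgue_integral_def)
    also have "\<dots> = of_real (u x) *
        (LINT r:{0..}|lborel. exp (- of_real (X * ln x) * (z + of_real r)) / (z + of_real r))"
      by (rule set_integral_mult_right)
    also note E1
    finally show ?thesis using pos[OF True] by simp
  next
    case False
    hence "u x = 0" by (intro u_support) auto
    thus ?thesis using False by (simp add: \<Phi>_def)
  qed
  have inner_x: "(LINT x|lborel. \<Phi> x r) = indicat_real {0..} r *\<^sub>R (M (z + of_real r) / (z + of_real r))" for r
  proof (cases "r \<ge> 0")
    case True
    have cont: "continuous_on J (\<lambda>x. of_real (u x) * exp (- of_real (X * ln x) * (z + of_real r)))"
      by (intro continuous_intros u_cont) (use pos in force)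
    have "(LINT x|lborel. \<Phi> x r) = (LINT x:J|lborel. of_real (u x) * exp (- of_real (X * ln x) * (z + of_real r)) / (z + of_real r))"
      unfolding set_lebesgue_integral_def using True
      by (intro Bochner_Integration.integral_cong refl) (simp add: \<Phi>_def k_def)
    also have "\<dots> = (LINT x:J|lborel. of_real (u x) * exp (- of_real (X * ln x) * (z + of_real r))) / (z + of_real r)"
      by (rule set_integral_divide_zero)
    also have "(LINT x:J|lborel. of_real (u x) * exp (- of_real (X * ln x) * (z + of_real r))) = M (z + of_real r)"
      unfolding M_eq_integral_J by (intro set_borel_integral_eq_integral(2) borel_integrable_atLeastAtMost' cont)
    finally show ?thesis using True by simp
  qed (simp add: \<Phi>_def)
  \<comment> \<open>\<open>Ufun\<close> is a gauge integral; Lebesgue integrability of the outer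
    function, supplied by Fubini, makes the two integrals agree.\<close>
  have "integrable lborel (\<lambda>x. LINT r|lborel. \<Phi> x r)"
    using lborel_pair.integrable_fst[OF \<Phi>_int] .
  hence "set_integrable lborel {0..} (\<lambda>x. of_real (u x) * E1 (z * of_nat X * of_real (ln x)))"
    unfolding inner_r set_integrable_def .
  hence "Ufun u (z * of_nat X) = (LINT x:{0..}|lborel. of_real (u x) * E1 (z * of_nat X * of_real (ln x)))"
    unfolding Ufun_def by (rule set_borel_integral_eq_integral(2)[symmetric])
  also have "\<dots> = (LINT x|lborel. LINT r|lborel. \<Phi> x r)"
    unfolding set_lebesgue_integral_def inner_r ..
  also have "\<dots> = (LINT r|lborel. LINT x|lborel. \<Phi> x r)"
    by (rule lborel_pair.Fubini_integral[OF \<Phi>_int, symmetric])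
  also have "\<dots> = V z" unfolding inner_x V_def set_lebesgue_integral_def ..
  finally show ?thesis .
qed

end

section \<open>The hybrid Euler--Hadamard product\<close>

lemma smooth_fun_has_derivs:
  assumes "smooth_fun u"
  shows "(u has_real_derivative deriv u x) (at x)" "continuous_on UNIV (deriv u)"
proof -
  have "((deriv ^^ 0) u) differentiable (at x)" "\<And>x. ((deriv ^^ 1) u) differentiable (at x)"
    using assms unfolding smooth_fun_def by blast+
  thus "(u has_real_derivative deriv u x) (at x)" "continuous_on UNIV (deriv u)"
    by (auto simp: DERIV_deriv_iff_real_differentiable continuous_on_eq_continuous_within
        intro: differentiable_imp_continuous_within)
qed

text \<open>From X < 2^X <= q^X the support ends strictly before exp (1 + 1/X). At its other end,
  exp 1, vanishing follows from continuity.\<close>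

lemma mollifierI:
  assumes "X \<ge> 1" "smooth_fun u" "q \<ge> 2"
    and supp: "\<forall>x. x \<notin> {exp 1 .. exp (1 + q powr (- real X))} \<longrightarrow> u x = 0"
    and "integral {0..} u = 1"
  shows "mollifier u (deriv u) X"
proof
  fix x assume x: "x \<notin> {exp 1<..<exp (1 + 1 / real X)}"
  have "real X < 2 ^ X" by simp
  also have "\<dots> \<le> q ^ X" using assms(3) by (intro power_mono) auto
  finally have "q powr (- real X) < 1 / real X"
    using assms(1,3) by (simp add: powr_minus powr_realpow inverse_eq_divide frac_less2)
  hence "x \<le> exp 1 \<or> x > exp (1 + q powr (- real X))" using x
    by (smt (verit) exp_less_cancel_iff greaterThanLessThan_iff)
  \<comment> \<open>The point exp 1 belongs to the closed support interval, but it is a limit from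
    the left of points where \<open>u\<close> is 0.\<close>
  thus "u x = 0"
  proof (cases "x = exp 1")
    case True
    have "isCont u (exp 1)" using smooth_fun_has_derivs(1)[OF assms(2)] DERIV_isCont by blast
    hence "(u \<longlongrightarrow> u (exp 1)) (at_left (exp 1))" unfolding isCont_def by (rule tendsto_within_subset) simp
    moreover have "eventually (\<lambda>y. u y = 0) (at_left (exp 1))"
      unfolding eventually_at_filter using supp by (intro always_eventually) auto
    hence "(u \<longlongrightarrow> 0) (at_left (exp 1))" by (rule tendsto_eventually)
    ultimately have "u (exp 1) = 0" by (intro tendsto_unique[OF trivial_limit_at_left_real])
    thus ?thesis using True by simp
  qed (use supp in auto)
qed (use assms smooth_fun_has_derivs in auto)

section \<open>The zeros as vertical progressions, and the product formula off the exceptional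
  set\<close>

context
  fixes R :: "'a::{finite,field} poly" and chi and lq :: real
  assumes prim: "primitive_char R chi" and R1: "R \<noteq> 1"
  defines "lq \<equiv> ln (real CARD('a))"
begin

text \<open>For b \<noteq> 0 these are all solutions \<rho> of exp (-\<rho> log q) = b, one for each
  branch of log b.\<close>

definition base_zero :: "complex \<Rightarrow> int \<Rightarrow> complex" where
  "base_zero b k = (2 * of_real pi * \<i> * of_int k - Ln b) / of_real (ln (real CARD('a)))"

lemma lq_pos': "lq > 0" unfolding lq_def by (rule lq_pos[OF prim R1])

lemma exp_base_zero:
  assumes "b \<noteq> 0"
  shows "exp (- base_zero b k * of_real lq) = b"
proof -
  have "exp (2 * of_real pi * \<i> * of_int k) = (1::complex)"
    by (auto simp: exp_eq_1 intro: exI[of _ k])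
  moreover have "- base_zero b k * of_real lq = Ln b - 2 * of_real pi * \<i> * of_int k"
    using lq_pos' by (simp add: base_zero_def lq_def)
  ultimately show ?thesis using assms by (simp add: exp_diff)
qed

lemma Lfun_zeros: "{\<rho>. Lfun chi \<rho> = 0} = (\<Union>b\<in>{b. poly (Lpoly R chi) b = 0}. range (base_zero b))"
proof (intro equalityI subsetI)
  fix \<rho> assume \<rho>: "\<rho> \<in> {\<rho>. Lfun chi \<rho> = 0}"
  define b where "b = exp (- \<rho> * of_real lq)"
  have "poly (Lpoly R chi) b = 0"
    using \<rho> Lfun_eq_poly[OF prim R1, of \<rho>] by (simp add: b_def lq_def)
  moreover have "exp (Ln b) = exp (- \<rho> * of_real lq)" by (simp add: b_def)
  then obtain k where "Ln b = - \<rho> * of_real lq + of_int (2 * k) * pi * \<i>"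
    unfolding exp_eq by blast
  hence "\<rho> = base_zero b k" using lq_pos' by (simp add: base_zero_def field_simps lq_def)
  ultimately show "\<rho> \<in> (\<Union>b\<in>{b. poly (Lpoly R chi) b = 0}. range (base_zero b))" by blast
next
  fix \<rho> assume "\<rho> \<in> (\<Union>b\<in>{b. poly (Lpoly R chi) b = 0}. range (base_zero b))"
  then obtain b k where bk: "poly (Lpoly R chi) b = 0" "\<rho> = base_zero b k" by blast
  hence "b \<noteq> 0" using poly_Lpoly_0[OF prim R1] by auto
  from exp_base_zero[OF this, of k] show "\<rho> \<in> {\<rho>. Lfun chi \<rho> = 0}"
    using bk Lfun_eq_poly[OF prim R1, of \<rho>] by (simp add: lq_def)
qed

text \<open>The zeros are partitioned by the root b below them. There are finitely many roots, so
  the unordered sum over zeros is a finite sum of the sums treated in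
  \<open>exp_neg_infsum_V\<close>, weighted by the multiplicities.\<close>

lemma Lfun_eq_PX_ZX:
  assumes moll: "mollifier u (deriv u) X" and s: "s \<notin> exc_set chi"
  shows "Lfun chi s = PX X chi s * ZX u X chi s"
proof -
  interpret mollifier u "deriv u" X by (rule moll)
  let ?C = "Lpoly R chi"
  define S where "S = {b. poly ?C b = 0}"
  define x where "x = exp (- s * of_real lq)"
  \<comment> \<open>W b is (s - \<rho>) log q for the zero \<rho> = \<open>base_zero b 0\<close>, so
    exp (-W b) = x / b.\<close>
  define W where "W = (\<lambda>b. s * of_real lq + Ln b)"
  have fin: "finite S" unfolding S_def using poly_Lpoly_0[OF prim R1] by (intro poly_roots_finite) auto
  have S0: "b \<noteq> 0" if "b \<in> S" for b using that poly_Lpoly_0[OF prim R1] by (auto simp: S_def)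
  have shift: "(s - base_zero b k) * of_real lq = z_shift (W b) k" for b k
    using lq_pos' by (simp add: base_zero_def z_shift_def W_def lq_def field_simps)
  have zero: "Lfun chi (base_zero b k) = 0" if "b \<in> S" for b k
    using Lfun_zeros that unfolding S_def by blast
  \<comment> \<open>The two alternatives in \<open>exc_set\<close> together say that some s - \<rho>
    is a nonpositive real; scaling by \<open>lq\<close> > 0 preserves this.\<close>
  have adm: "z_shift (W b) k \<notin> \<real>\<^sub>\<le>\<^sub>0" if "b \<in> S" for b k
  proof
    assume "z_shift (W b) k \<in> \<real>\<^sub>\<le>\<^sub>0"
    hence "Re (s - base_zero b k) \<le> 0" "Im (s - base_zero b k) = 0"
      using lq_pos' unfolding shift[symmetric] by (auto simp: complex_nonpos_Reals_iff mult_le_0_iff)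
    hence "s = base_zero b k \<or> Arg (s - base_zero b k) = pi"
      unfolding Arg_eq_pi by (auto simp: complex_eq_iff)
    thus False using s zero[OF that, of k] unfolding exc_set_def by blast
  qed
  define f where "f = (\<lambda>\<rho>. of_int (zorder (Lfun chi) \<rho>) *
        Ufun u ((s - \<rho>) * of_real (ln (real (CARD('a)))) * of_nat X))"
  have f: "f (base_zero b k) = of_nat (order b ?C) * V (z_shift (W b) k)" if "b \<in> S" for b k
  proof -
    have "zorder (Lfun chi) (base_zero b k) = int (order b ?C)"
      using zorder_Lfun[OF prim R1 zero[OF that, of k]] exp_base_zero[OF S0[OF that], of k] by (simp add: lq_def)
    moreover have "Ufun u ((s - base_zero b k) * of_real (ln (real (CARD('a)))) * of_nat X) = V (z_shift (W b) k)"
      unfolding lq_def[symmetric] shift by (rule Ufun_eq_V[OF adm[OF that]])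
    ultimately show ?thesis by (simp add: f_def)
  qed
  have inj: "inj (base_zero b)" for b
    using lq_pos' by (auto simp: inj_on_def base_zero_def lq_def)
  have "(f has_sum (of_nat (order b ?C) * (\<Sum>\<^sub>\<infinity>k. V (z_shift (W b) k)))) (range (base_zero b))" if "b \<in> S" for b
  proof -
    have "((\<lambda>k. of_nat (order b ?C) * V (z_shift (W b) k)) has_sum
        (of_nat (order b ?C) * (\<Sum>\<^sub>\<infinity>k. V (z_shift (W b) k)))) UNIV"
      by (intro has_sum_cmult_right has_sum_infsum V_z_shift_summable adm that)
    thus ?thesis unfolding has_sum_reindex[OF inj] o_def f[OF that] .
  qed
  \<comment> \<open>The progressions are disjoint because exp (-\<rho> log q) recovers the root
    b.\<close>
  moreover have "range (base_zero b) \<inter> range (base_zero b') = {}" if "b \<in> S" "b' \<in> S" "b \<noteq> b'" for b b'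
  proof (rule ccontr)
    assume "range (base_zero b) \<inter> range (base_zero b') \<noteq> {}"
    then obtain k k' where "base_zero b k = base_zero b' k'" by auto
    thus False using exp_base_zero[OF S0[OF that(1)], of k] exp_base_zero[OF S0[OF that(2)], of k'] that(3) by simp
  qed
  ultimately have "(f has_sum (\<Sum>b\<in>S. of_nat (order b ?C) * (\<Sum>\<^sub>\<infinity>k. V (z_shift (W b) k)))) (\<Union>b\<in>S. range (base_zero b))"
    using fin by (intro sum_has_sum) auto
  hence "infsum f {\<rho>. Lfun chi \<rho> = 0} = (\<Sum>b\<in>S. of_nat (order b ?C) * (\<Sum>\<^sub>\<infinity>k. V (z_shift (W b) k)))"
    unfolding Lfun_zeros S_def by (rule infsumI)
  hence "ZX u X chi s = exp (\<Sum>b\<in>S. of_nat (order b ?C) * (- (\<Sum>\<^sub>\<infinity>k. V (z_shift (W b) k))))"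
    by (simp add: ZX_def f_def sum_negf)
  also have "\<dots> = (\<Prod>b\<in>S. exp (- (\<Sum>\<^sub>\<infinity>k. V (z_shift (W b) k))) ^ order b ?C)"
    using fin by (simp only: exp_sum exp_of_nat_mult)
  also have "\<dots> = (\<Prod>b\<in>S. ((1 - x / b) * exp (\<Sum>n=1..X. (x / b) ^ n / of_nat n)) ^ order b ?C)"
  proof (intro prod.cong refl)
    fix b assume b: "b \<in> S"
    have "exp (- W b) = x / b"
      using S0[OF b] by (simp add: W_def x_def exp_minus exp_add exp_diff field_simps)
    thus "exp (- (\<Sum>\<^sub>\<infinity>k. V (z_shift (W b) k))) ^ order b ?C =
        ((1 - x / b) * exp (\<Sum>n=1..X. (x / b) ^ n / of_nat n)) ^ order b ?C"
      using exp_neg_infsum_V[of "W b", OF adm[OF b]] by simp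
  qed
  finally have "ZX u X chi s = (\<Prod>b\<in>S. ((1 - x / b) * exp (\<Sum>n=1..X. (x / b) ^ n / of_nat n)) ^ order b ?C)" .
  thus ?thesis using Lfun_eq_PX_prod[OF prim R1, of s X] unfolding S_def x_def lq_def by simp
qed

lemma continuous_on_Lfun: "continuous_on A (Lfun chi)"
proof -
  have "Lfun chi = (\<lambda>s. poly (Lpoly R chi) (exp (- s * of_real lq)))"
    unfolding lq_def by (rule ext) (rule Lfun_eq_poly[OF prim R1])
  thus ?thesis by (simp only:) (intro continuous_intros)
qed

lemma continuous_on_PX: "continuous_on A (PX X chi)"
proof -
  have "PX X chi = (\<lambda>s. exp (\<Sum>n=1..X. Mcoeff chi n * exp (- s * of_real lq) ^ n / (of_nat n * of_real lq)))"
    unfolding lq_def by (rule ext) (rule PX_eq[OF prim R1])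
  thus ?thesis using lq_pos' by (simp only:) (intro continuous_intros, auto)
qed

end

theorem theorem1p2:
  fixes u :: "real \<Rightarrow> real" and X :: nat
    and R :: "'a::{finite,field} poly" and chi :: "'a poly \<Rightarrow> complex"
  assumes "X \<ge> 1"
    and "smooth_fun u"
    and "\<forall>x. u x \<ge> 0"
    and "\<forall>x. x \<notin> {exp 1 .. exp (1 + real (CARD('a)) powr (- real X))} \<longrightarrow> u x = 0"
    and "integral {0..} u = 1"
    and "primitive_char R chi" and "R \<noteq> 1"
  shows "(\<forall>s. s \<notin> exc_set chi \<longrightarrow> Lfun chi s = PX X chi s * ZX u X chi s) \<and>
         (\<forall>s\<in>exc_set chi. \<exists>c. (ZX u X chi \<longlongrightarrow> c) (at s within - exc_set chi) \<and>
                              Lfun chi s = PX X chi s * c)"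
proof -
  have "CARD('a) > 1" using card_field_gt_1[OF assms(6,7)] by simp
  hence "real CARD('a) \<ge> 2" by simp
  hence moll: "mollifier u (deriv u) X" using assms by (intro mollifierI)
  have eq: "Lfun chi s = PX X chi s * ZX u X chi s" if "s \<notin> exc_set chi" for s
    by (rule Lfun_eq_PX_ZX[OF assms(6,7) moll that])
  have PX_nz: "PX X chi s \<noteq> 0" for s by (simp add: PX_def)
  \<comment> \<open>Off \<open>exc_set chi\<close>, \<open>ZX\<close> coincides with L / P_X, which
    is continuous on the whole plane since \<open>PX\<close> is an exponential. Its value at s is
    therefore the limit, also at exceptional s.\<close>
  have "(ZX u X chi \<longlongrightarrow> Lfun chi s / PX X chi s) (at s within - exc_set chi)" for s
  proof (rule Lim_transform_eventually)
    have "continuous_on UNIV (\<lambda>s. Lfun chi s / PX X chi s)"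
      using PX_nz by (intro continuous_on_divide continuous_on_Lfun[OF assms(6,7)] continuous_on_PX[OF assms(6,7)]) auto
    hence "((\<lambda>s. Lfun chi s / PX X chi s) \<longlongrightarrow> Lfun chi s / PX X chi s) (at s)"
      by (simp add: continuous_on_def)
    thus "((\<lambda>s. Lfun chi s / PX X chi s) \<longlongrightarrow> Lfun chi s / PX X chi s) (at s within - exc_set chi)"
      by (rule tendsto_within_subset) simp
    show "eventually (\<lambda>t. Lfun chi t / PX X chi t = ZX u X chi t) (at s within - exc_set chi)"
      unfolding eventually_at_filter using eq PX_nz by (intro always_eventually) auto
  qed
  moreover have "Lfun chi s = PX X chi s * (Lfun chi s / PX X chi s)" for s using PX_nz by simp
  ultimately show ?thesis using eq by blast
qed

end
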